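(* Let $0 < \alpha, p < 1$. There exist $n_0$ and $\mu > 0$ such that if $H$ is an $(n,p,\mu,\alpha)$ $3$-graph with $n \ge n_0$, then $H$ has a perfect cherry-packing if $4 \mid n$, and $H$ has a perfect $C_4(2+1)$-packing if $6 \mid n$.
   Context: A $3$-graph $H$ is a set of $3$-element subsets (edges) of a vertex set $V(H)$. For $X_1,X_2,X_3 \subseteq V(H)$, $e(X_1,X_2,X_3)$ is the number of $(x_1,x_2,x_3)\in X_1\times X_2\times X_3$ with $\{x_1,x_2,x_3\}\in H$. An $(n,p,\mu,\alpha)$ $3$-graph is a $3$-graph $H$ on $n$ vertices such that $e(X_1,X_2,X_3) \ge p|X_1||X_2||X_3| - \mu n^3$ for all $X_1,X_2,X_3\subseteq V(H)$ and every vertex lies in at least $\alpha\binom{n}{2}$ edges. The cherry is the $3$-graph consisting of two edges sharing exactly two vertices (4 vertices). $C_4(2+1)$ is the $3$-graph with vertex set $\{1,2,3,4,a,b\}$ and edges $\{1,2,a\},\{1,2,b\},\{3,4,a\},\{3,4,b\}$. A perfect $F$-packing of $H$ is a partition of $V(H)$ into sets each spanning a copy of $F$. *)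

theory Defs
  imports Complex_Main "HOL-Library.Disjoint_Sets"
begin

text \<open>A 3-graph is given by its vertex set and its edge set; all 3-graphs are finite.\<close>

definition three_graph :: "'a set \<Rightarrow> 'a set set \<Rightarrow> bool" where
  "three_graph V E \<longleftrightarrow> finite V \<and> (\<forall>e\<in>E. e \<subseteq> V \<and> card e = 3)"

text \<open>Ordered triples are counted, so an edge inside the intersection of the three sets
  contributes six times.\<close>

definition edge_count :: "'a set set \<Rightarrow> 'a set \<Rightarrow> 'a set \<Rightarrow> 'a set \<Rightarrow> nat" where
  "edge_count E X1 X2 X3 =
     card {(x1, x2, x3). x1 \<in> X1 \<and> x2 \<in> X2 \<and> x3 \<in> X3 \<and> {x1, x2, x3} \<in> E}"

definition vertex_degree :: "'a set set \<Rightarrow> 'a \<Rightarrow> nat" where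
  "vertex_degree E v = card {e \<in> E. v \<in> e}"

definition dense_three_graph ::
  "nat \<Rightarrow> real \<Rightarrow> real \<Rightarrow> real \<Rightarrow> 'a set \<Rightarrow> 'a set set \<Rightarrow> bool" where
  "dense_three_graph n p \<mu> \<alpha> V E \<longleftrightarrow>
     three_graph V E \<and> card V = n \<and>
     (\<forall>X1 X2 X3. X1 \<subseteq> V \<and> X2 \<subseteq> V \<and> X3 \<subseteq> V \<longrightarrow>
        real (edge_count E X1 X2 X3) \<ge>
          p * real (card X1) * real (card X2) * real (card X3) - \<mu> * real n ^ 3) \<and>
     (\<forall>v\<in>V. real (vertex_degree E v) \<ge> \<alpha> * real (n choose 2))"

text \<open>Copies are not required to be induced.\<close>

definition spans_copy :: "'b set \<Rightarrow> 'b set set \<Rightarrow> 'a set set \<Rightarrow> 'a set \<Rightarrow> bool" where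
  "spans_copy VF EF E S \<longleftrightarrow> (\<exists>f. bij_betw f VF S \<and> (\<forall>e\<in>EF. f ` e \<in> E))"

definition has_perfect_packing ::
  "'b set \<Rightarrow> 'b set set \<Rightarrow> 'a set \<Rightarrow> 'a set set \<Rightarrow> bool" where
  "has_perfect_packing VF EF V E \<longleftrightarrow>
     (\<exists>P. partition_on V P \<and> (\<forall>S\<in>P. spans_copy VF EF E S))"

definition cherry_verts :: "nat set" where
  "cherry_verts = {1, 2, 3, 4}"

definition cherry_edges :: "nat set set" where
  "cherry_edges = {{1, 2, 3}, {1, 2, 4}}"

text \<open>The 3-graph \<open>C\<^sub>4(2+1)\<close>, with its vertices \<open>a\<close> and \<open>b\<close> encoded as 5 and 6.\<close>

definition C4_verts :: "nat set" where
  "C4_verts = {1, 2, 3, 4, 5, 6}"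

definition C4_edges :: "nat set set" where
  "C4_edges = {{1, 2, 5}, {1, 2, 6}, {3, 4, 5}, {3, 4, 6}}"

end

theory Submission
  imports Defs "HOL-Analysis.Convex" "HOL-Library.Multiset"
begin

text \<open>
  The proof is by absorption. Call a multiset tileable if it is a sum of possibly degenerate copies of
  the tile (vertices may repeat). Two vertices are exchangeable if many tuples \<open>Q\<close> of fixed length form a
  tileable multiset together with either of them. Weak quasirandomness makes many pairs in \<open>X \<times> Y\<close>
  exchangeable for all linear-sized \<open>X\<close>, \<open>Y\<close>: for the cherry it suffices to blow up an edge, for
  \<open>C\<^sub>4(2+1)\<close> one blows up a \<open>3 \<times> 3\<close> grid one corner of which is split into two vertices. Hence, chaining three
  exchanges, all vertices outside a small bad set are pairwise exchangeable, and every tuple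
  of good vertices of the size of a tile has a positive proportion of absorbing tuples.

  A linear number of disjoint tuples absorbing everything is then selected greedily, which derandomises
  the usual random choice. The bad vertices are covered one by one by tiles through them (the degree
  condition), the rest is tiled greedily up to a few vertices, and these are absorbed.
\<close>

section \<open>Tuples\<close>

text \<open>The hypothesis on boxes X \<times> Y \<times> Z controls an added edge only if every
  other edge meets it in at most one vertex. So counting is available for linear patterns alone, and
  neither tile is linear. Both arise from linear patterns by doubling a vertex, at the price of
  squaring a density: a cherry from an edge, \<open>C\<^sub>4(2+1)\<close> from two edges through
  the doubled vertex. Degenerate copies do no harm, since all but a fraction O(1/n) of the maps are
  injective.

  Density is known between linear-sized sets and says nothing about a given pair of vertices. Hence
  a chain of three: each end vertex has linearly many partners, and the middle exchange joins the
  two sets of partners. For a vertex with too few exchanges only the degree condition is left. The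
  bound on the number of such vertices is therefore fixed first, small against the tile density that
  the degree condition gives.

  The grid is a linear pattern whose rows and columns both cover every vertex once; splitting a
  corner makes the two covers differ in exactly one vertex.\<close>

definition tuples :: "'a set \<Rightarrow> nat \<Rightarrow> 'a list set" where
  "tuples V k = {xs. set xs \<subseteq> V \<and> length xs = k}"

lemma finite_tuples: "finite V \<Longrightarrow> finite (tuples V k)"
  unfolding tuples_def by (rule finite_lists_length_eq)

lemma card_tuples: "finite V \<Longrightarrow> card (tuples V k) = card V ^ k"
  unfolding tuples_def by (rule card_lists_length_eq)

lemma tuples_mono: "X \<subseteq> V \<Longrightarrow> tuples X k \<subseteq> tuples V k"
  unfolding tuples_def by auto

lemma tuples_0: "tuples V 0 = {[]}"
  unfolding tuples_def by auto

lemma append_in_tuples: "xs \<in> tuples V k \<Longrightarrow> ys \<in> tuples V l \<Longrightarrow> xs @ ys \<in> tuples V (k + l)"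
  unfolding tuples_def by auto

text \<open>Concatenation is injective here because all first parts have the same length; this is
  what lets the densities of gadgets multiply.\<close>

lemma card_append_ge:
  fixes N \<alpha> \<beta> :: real
  assumes "finite A" "finite C" "\<And>xs. xs \<in> A \<Longrightarrow> length xs = a"
    and A: "real (card A) \<ge> \<alpha> * N ^ a"
    and B: "\<And>xs. xs \<in> A \<Longrightarrow> real (card {ys. xs @ ys \<in> C}) \<ge> \<beta> * N ^ b"
    and "\<beta> \<ge> 0" "N \<ge> 0"
  shows "real (card C) \<ge> \<alpha> * \<beta> * N ^ (a + b)"
proof -
  let ?B = "\<lambda>xs. {ys. xs @ ys \<in> C}"
  have fB: "finite (?B xs)" for xs
    by (rule finite_imageD[of "\<lambda>ys. xs @ ys"])
      (auto intro: finite_subset[OF _ \<open>finite C\<close>] simp: inj_on_def)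
  have "\<alpha> * \<beta> * N ^ (a + b) = (\<alpha> * N ^ a) * (\<beta> * N ^ b)"
    by (simp add: power_add)
  also have "\<dots> \<le> real (card A) * (\<beta> * N ^ b)"
    using A assms(6,7) by (intro mult_right_mono) auto
  also have "\<dots> = (\<Sum>xs\<in>A. \<beta> * N ^ b)" by simp
  also have "\<dots> \<le> (\<Sum>xs\<in>A. real (card (?B xs)))"
    by (intro sum_mono B)
  also have "\<dots> = real (card (Sigma A ?B))"
    using \<open>finite A\<close> fB by (subst card_SigmaI) auto
  also have "card (Sigma A ?B) \<le> card C"
  proof (rule card_inj_on_le[of "\<lambda>(xs, ys). xs @ ys"])
    show "inj_on (\<lambda>(xs, ys). xs @ ys) (Sigma A ?B)"
      using assms(3) by (fastforce simp: inj_on_def)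
  qed (use \<open>finite C\<close> in auto)
  finally show ?thesis by simp
qed

text \<open>A union bound over the k positions. Both sides carry a factor \<open>card V\<close>,
  which avoids the exponent k - 1.\<close>

lemma card_tuples_meeting:
  assumes "finite V" "finite Z"
  shows "card {xs \<in> tuples V k. set xs \<inter> Z \<noteq> {}} * card V \<le> k * card Z * card V ^ k"
proof (induction k)
  case 0
  then show ?case by (simp add: tuples_0)
next
  case (Suc k)
  let ?H = "\<lambda>k. {xs \<in> tuples V k. set xs \<inter> Z \<noteq> {}}"
  have sub: "?H (Suc k) \<subseteq> (\<lambda>(x, xs). x # xs) ` (Z \<times> tuples V k) \<union> (\<lambda>(x, xs). x # xs) ` (V \<times> ?H k)"
  proof
    fix xs assume "xs \<in> ?H (Suc k)"
    then show "xs \<in> (\<lambda>(x, xs). x # xs) ` (Z \<times> tuples V k) \<union> (\<lambda>(x, xs). x # xs) ` (V \<times> ?H k)"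
      by (cases xs) (auto simp: tuples_def)
  qed
  have fin: "finite (tuples V k)" "finite (?H k)"
    using finite_tuples[OF assms(1)] by auto
  have "card (?H (Suc k)) \<le> card ((\<lambda>(x, xs). x # xs) ` (Z \<times> tuples V k) \<union> (\<lambda>(x, xs). x # xs) ` (V \<times> ?H k))"
    using fin assms by (intro card_mono[OF _ sub]) auto
  also have "\<dots> \<le> card (Z \<times> tuples V k) + card (V \<times> ?H k)"
    using fin assms by (intro order_trans[OF card_Un_le] add_mono card_image_le) auto
  also have "\<dots> = card Z * card V ^ k + card V * card (?H k)"
    by (simp add: card_cartesian_product card_tuples assms)
  finally have "card (?H (Suc k)) * card V \<le> (card Z * card V ^ k + card V * card (?H k)) * card V"
    by (rule mult_right_mono) simp
  also have "\<dots> = card Z * card V ^ Suc k + card V * (card (?H k) * card V)"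
    by (simp add: algebra_simps)
  also have "\<dots> \<le> card Z * card V ^ Suc k + card V * (k * card Z * card V ^ k)"
    by (intro add_left_mono mult_left_mono Suc.IH) simp
  finally show ?case by (simp add: algebra_simps)
qed

text \<open>A new head repeats one of at most k entries of the tail, or the tail already has a
  repetition. The square is a crude bound for the number of pairs of positions.\<close>

lemma card_tuples_not_distinct:
  assumes "finite V"
  shows "card {xs \<in> tuples V k. \<not> distinct xs} * card V \<le> k\<^sup>2 * card V ^ k"
proof (induction k)
  case 0
  then show ?case by (simp add: tuples_0)
next
  case (Suc k)
  let ?H = "\<lambda>k. {xs \<in> tuples V k. \<not> distinct xs}"
  have sub: "?H (Suc k) \<subseteq> (\<lambda>(xs, x). x # xs) ` (Sigma (tuples V k) set) \<union> (\<lambda>(x, xs). x # xs) ` (V \<times> ?H k)"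
  proof
    fix xs assume "xs \<in> ?H (Suc k)"
    then show "xs \<in> (\<lambda>(xs, x). x # xs) ` (Sigma (tuples V k) set) \<union> (\<lambda>(x, xs). x # xs) ` (V \<times> ?H k)"
      by (cases xs) (auto simp: tuples_def)
  qed
  have fin: "finite (tuples V k)" "finite (?H k)"
    using finite_tuples[OF assms(1)] by auto
  have "card (?H (Suc k)) \<le> card ((\<lambda>(xs, x). x # xs) ` (Sigma (tuples V k) set) \<union> (\<lambda>(x, xs). x # xs) ` (V \<times> ?H k))"
    using fin assms by (intro card_mono[OF _ sub]) auto
  also have "\<dots> \<le> card (Sigma (tuples V k) set) + card (V \<times> ?H k)"
    using fin assms by (intro order_trans[OF card_Un_le] add_mono card_image_le) auto
  also have "card (Sigma (tuples V k) set) = (\<Sum>xs\<in>tuples V k. card (set xs))"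
    using fin by (intro card_SigmaI) auto
  also have "\<dots> \<le> (\<Sum>xs\<in>tuples V k. k)"
    by (intro sum_mono) (auto simp: tuples_def card_length)
  finally have "card (?H (Suc k)) \<le> k * card V ^ k + card V * card (?H k)"
    by (simp add: card_cartesian_product card_tuples assms mult.commute)
  then have "card (?H (Suc k)) * card V \<le> (k * card V ^ k + card V * card (?H k)) * card V"
    by (rule mult_right_mono) simp
  also have "\<dots> = k * card V ^ Suc k + card V * (card (?H k) * card V)"
    by (simp add: algebra_simps)
  also have "\<dots> \<le> k * card V ^ Suc k + card V * (k\<^sup>2 * card V ^ k)"
    by (intro add_left_mono mult_left_mono Suc.IH) simp
  also have "\<dots> \<le> (Suc k)\<^sup>2 * card V ^ Suc k"
    by (simp add: power2_eq_square algebra_simps)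
  finally show ?case .
qed

text \<open>The passage from possibly degenerate tuples to genuine ones: the tuples that repeat an
  entry or meet \<open>Z\<close> are of lower order and by \<open>c\<close> fewer than those in
  \<open>F\<close>.\<close>

lemma ex_distinct_avoiding:
  fixes c :: real
  assumes "finite V" "finite Z" "V \<noteq> {}" "F \<subseteq> tuples V k"
    and F: "real (card F) \<ge> c * real (card V) ^ k"
    and c: "real k * real (card Z) + (real k)\<^sup>2 < c * real (card V)"
  obtains xs where "xs \<in> F" "distinct xs" "set xs \<inter> Z = {}"
proof -
  let ?n = "real (card V)"
  let ?B = "{xs \<in> tuples V k. set xs \<inter> Z \<noteq> {}} \<union> {xs \<in> tuples V k. \<not> distinct xs}"
  have n: "?n > 0" using assms by (simp add: card_gt_0_iff)
  have fin: "finite ?B" using finite_tuples[OF assms(1)] by simp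
  have "card ?B \<le> card {xs \<in> tuples V k. set xs \<inter> Z \<noteq> {}} + card {xs \<in> tuples V k. \<not> distinct xs}"
    by (rule card_Un_le)
  then have "card ?B * card V
      \<le> (card {xs \<in> tuples V k. set xs \<inter> Z \<noteq> {}} + card {xs \<in> tuples V k. \<not> distinct xs}) * card V"
    by (rule mult_le_mono1)
  also have "\<dots> \<le> k * card Z * card V ^ k + k\<^sup>2 * card V ^ k"
    unfolding add_mult_distrib
    by (intro add_mono card_tuples_meeting card_tuples_not_distinct assms)
  finally have "real (card ?B * card V) \<le> real (k * card Z * card V ^ k + k\<^sup>2 * card V ^ k)"
    by (rule of_nat_mono)
  then have "real (card ?B) * ?n \<le> (real k * real (card Z) + (real k)\<^sup>2) * ?n ^ k"
    by (simp add: algebra_simps)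
  also have "\<dots> < c * ?n * ?n ^ k"
    using c n by (intro mult_strict_right_mono) auto
  also have "\<dots> = (c * ?n ^ k) * ?n" by simp
  also have "\<dots> \<le> real (card F) * ?n" using F by (intro mult_right_mono) auto
  finally have "card ?B < card F" using n by simp
  then have "\<not> F \<subseteq> ?B" using card_mono[OF fin, of F] by linarith
  then obtain xs where "xs \<in> F" "xs \<notin> ?B" by auto
  with \<open>F \<subseteq> tuples V k\<close> that show ?thesis by auto
qed

text \<open>Reverse Markov inequality: elements below the threshold contribute at most half of the
  assumed sum, and each of the others at most \<open>M\<close>.\<close>

lemma sum_markov:
  fixes w :: "'a \<Rightarrow> real" and M N \<gamma> :: real
  assumes "finite V" "N = card V" "N > 0" "M > 0"
    and le: "\<And>v. v \<in> V \<Longrightarrow> w v \<le> M"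
    and ge: "(\<Sum>v\<in>V. w v) \<ge> \<gamma> * (N * M)" and "\<gamma> \<ge> 0"
  shows "real (card {v \<in> V. w v \<ge> \<gamma> / 2 * M}) \<ge> \<gamma> / 2 * N"
proof -
  let ?X = "{v \<in> V. w v \<ge> \<gamma> / 2 * M}"
  have "\<gamma> * (N * M) \<le> (\<Sum>v\<in>V. w v)" by (rule ge)
  also have "\<dots> \<le> (\<Sum>v\<in>V. M * of_bool (v \<in> ?X) + \<gamma> / 2 * M)"
  proof (rule sum_mono)
    fix v assume "v \<in> V"
    moreover have "\<gamma> / 2 * M \<ge> 0" using assms by simp
    ultimately show "w v \<le> M * of_bool (v \<in> ?X) + \<gamma> / 2 * M"
      using le[of v] by (cases "v \<in> ?X") auto
  qed
  also have "\<dots> = M * (\<Sum>v\<in>V. of_bool (v \<in> ?X)) + N * (\<gamma> / 2 * M)"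
    by (simp add: sum.distrib sum_distrib_left assms(2))
  also have "(\<Sum>v\<in>V. of_bool (v \<in> ?X)) = real (card ?X)"
    using assms(1) by (simp add: of_bool_def sum.If_cases Int_def)
  finally have "(\<gamma> / 2 * N) * M \<le> real (card ?X) * M" by (simp add: field_simps)
  then show ?thesis using \<open>M > 0\<close> by simp
qed

section \<open>Exchanging vertices in tilings\<close>

text \<open>Tiles are multisets so that degenerate copies can be counted along with genuine ones; only the
  duplicate-free ones have to span a copy.\<close>

locale tile_system =
  fixes V :: "'a set" and tile :: "'a multiset \<Rightarrow> bool" and spans :: "'a set \<Rightarrow> bool" and r :: nat
  assumes finite_V: "finite V"
    and size_tile: "tile M \<Longrightarrow> size M = Suc r"
    and spans_tile: "tile M \<Longrightarrow> \<forall>x. count M x \<le> 1 \<Longrightarrow> spans (set_mset M)"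
    and card_spans: "spans S \<Longrightarrow> card S = Suc r"
begin

inductive tileable :: "'a multiset \<Rightarrow> bool" where
  tileable_empty: "tileable {#}"
| tileable_add_tile: "tile M \<Longrightarrow> tileable N \<Longrightarrow> tileable (M + N)"

definition packable :: "'a set \<Rightarrow> bool" where
  "packable S \<longleftrightarrow> (\<exists>P. partition_on S P \<and> (\<forall>B\<in>P. spans B))"

text \<open>Between multisets rather than vertices, so that exchanges of single vertices add up to
  the exchange of a whole tile.\<close>

definition swaps :: "nat \<Rightarrow> 'a multiset \<Rightarrow> 'a multiset \<Rightarrow> 'a list set" where
  "swaps t M N = {Q \<in> tuples V t. tileable (M + mset Q) \<and> tileable (N + mset Q)}"

lemma tileable_tile: "tile M \<Longrightarrow> tileable M"
  using tileable_add_tile[OF _ tileable_empty] by simp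

lemma tileable_add: "tileable M \<Longrightarrow> tileable N \<Longrightarrow> tileable (M + N)"
  by (induction rule: tileable.induct) (auto intro: tileable_add_tile simp: add.assoc)

lemma packable_empty: "packable {}"
  unfolding packable_def by (auto intro!: exI[of _ "{}"] simp: partition_on_def)

text \<open>Serves to find the size of the final leftover modulo the tile size, which is known only
  through the packed parts around it.\<close>

lemma dvd_card_packable:
  assumes "packable S"
  shows "Suc r dvd card S"
proof -
  from assms obtain P where P: "partition_on S P" "\<forall>B\<in>P. spans B"
    unfolding packable_def by auto
  have "card (\<Union>P) = sum card P"
  proof (rule card_Union_disjoint)
    show "pairwise disjnt P" using P(1) by (auto simp: partition_on_def disjoint_def pairwise_def disjnt_def)
    show "finite B" if "B \<in> P" for B using P(2) card_spans that by (intro card_ge_0_finite) simp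
  qed
  then have "card S = sum card P" using P(1) by (simp add: partition_on_def)
  then show ?thesis using P(2) card_spans by (metis dvd_refl dvd_sum)
qed

lemma packable_Un:
  assumes "packable S" "packable T" "S \<inter> T = {}"
  shows "packable (S \<union> T)"
proof -
  from assms obtain P Q where "partition_on S P" "\<forall>B\<in>P. spans B" "partition_on T Q" "\<forall>B\<in>Q. spans B"
    unfolding packable_def by auto
  then show ?thesis
    unfolding packable_def using assms(3)
    by (intro exI[of _ "P \<union> Q"]) (auto simp: partition_on_def intro!: disjoint_union)
qed

text \<open>If no vertex is repeated in the sum, none is repeated in a summand and no two summands
  meet, so the tiles are genuine and disjoint. Degeneracy thus has to be excluded only once, for the
  whole multiset.\<close>

lemma packable_tileable:
  "tileable M \<Longrightarrow> \<forall>x. count M x \<le> 1 \<Longrightarrow> packable (set_mset M)"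
proof (induction rule: tileable.induct)
  case tileable_empty
  then show ?case by (simp add: packable_empty)
next
  case (tileable_add_tile M N)
  have le: "count M x + count N x \<le> 1" for x
    using tileable_add_tile.prems by simp
  have M: "\<forall>x. count M x \<le> 1" and N: "\<forall>x. count N x \<le> 1"
    using le by (meson add_leE)+
  have "set_mset M \<noteq> {}"
    using size_tile[OF tileable_add_tile.hyps(1)] by auto
  then have "packable (set_mset M)"
    unfolding packable_def using spans_tile[OF tileable_add_tile.hyps(1) M]
    by (intro exI[of _ "{set_mset M}"]) (auto simp: partition_on_def disjoint_def)
  moreover have "set_mset M \<inter> set_mset N = {}"
  proof (rule ccontr)
    assume "set_mset M \<inter> set_mset N \<noteq> {}"
    then obtain x where "x \<in># M" "x \<in># N" by auto
    then have "count M x \<ge> 1" "count N x \<ge> 1" by simp_all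
    with le[of x] show False by linarith
  qed
  ultimately show ?case
    using tileable_add_tile.IH[OF N] by (simp add: packable_Un)
qed

lemma packable_set:
  "tileable (mset xs) \<Longrightarrow> distinct xs \<Longrightarrow> packable (set xs)"
  using packable_tileable[of "mset xs"] by (simp add: distinct_count_atmost_1)

section \<open>Composing exchanges\<close>

lemma finite_swaps: "finite (swaps t M N)"
  unfolding swaps_def using finite_tuples[OF finite_V] by simp

lemma swaps_sym: "swaps t M N = swaps t N M"
  unfolding swaps_def by auto

lemma card_swaps_le: "card (swaps t M N) \<le> card V ^ t"
  unfolding card_tuples[OF finite_V, symmetric] swaps_def
  by (intro card_mono finite_tuples finite_V) auto

lemma append_in_swaps:
  assumes "Q \<in> swaps t M N" "R \<in> swaps u M' N'"
  shows "Q @ R \<in> swaps (t + u) (M + M') (N + N')"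
proof -
  have "tileable ((M + mset Q) + (M' + mset R))" "tileable ((N + mset Q) + (N' + mset R))"
    using assms by (auto simp: swaps_def intro: tileable_add)
  then show ?thesis
    using assms by (auto simp: swaps_def append_in_tuples ac_simps)
qed

text \<open>The middle vertex joins the common tuple. Next to \<open>M\<close> it is tiled with
  \<open>R\<close>, next to \<open>N\<close> with \<open>Q\<close>.\<close>

lemma Cons_append_in_swaps:
  assumes "x \<in> V" "Q \<in> swaps t M {#x#}" "R \<in> swaps u {#x#} N"
  shows "x # Q @ R \<in> swaps (Suc (t + u)) M N"
proof -
  have "tileable ((M + mset Q) + ({#x#} + mset R))" "tileable (({#x#} + mset Q) + (N + mset R))"
    by (rule tileable_add; use assms in \<open>simp add: swaps_def\<close>)+
  then show ?thesis
    using assms by (auto simp: swaps_def tuples_def ac_simps)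
qed

lemma card_swaps_add:
  fixes n :: real
  assumes "real (card (swaps t M N)) \<ge> \<gamma> * n ^ t" "real (card (swaps u M' N')) \<ge> \<delta> * n ^ u"
    and "\<delta> \<ge> 0" "n \<ge> 0"
  shows "real (card (swaps (t + u) (M + M') (N + N'))) \<ge> \<gamma> * \<delta> * n ^ (t + u)"
proof (rule card_append_ge[OF finite_swaps finite_swaps _ assms(1) _ assms(3,4)])
  fix xs assume xs: "xs \<in> swaps t M N"
  then show "length xs = t" by (simp add: swaps_def tuples_def)
  let ?Y = "{ys. xs @ ys \<in> swaps (t + u) (M + M') (N + N')}"
  have "finite ?Y"
    by (rule finite_imageD[of "\<lambda>ys. xs @ ys"])
      (auto intro: finite_subset[OF _ finite_swaps] simp: inj_on_def)
  then have "card (swaps u M' N') \<le> card ?Y"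
    by (rule card_mono) (use append_in_swaps[OF xs] in auto)
  with assms(2) show "\<delta> * n ^ u \<le> real (card ?Y)" by linarith
qed

text \<open>The middle vertex is the head of the new tuple and the fixed lengths separate
  \<open>Q\<close> from \<open>R\<close>, so the products over different middle vertices are counted
  disjointly.\<close>

lemma card_swaps_chain:
  "(\<Sum>x\<in>V. card (swaps t M {#x#}) * card (swaps u {#x#} N)) \<le> card (swaps (Suc (t + u)) M N)"
proof -
  let ?D = "SIGMA x:V. swaps t M {#x#} \<times> swaps u {#x#} N"
  have "(\<Sum>x\<in>V. card (swaps t M {#x#}) * card (swaps u {#x#} N)) = card ?D"
    using finite_V finite_swaps by (subst card_SigmaI) (auto simp: card_cartesian_product)
  also have "\<dots> \<le> card (swaps (Suc (t + u)) M N)"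
  proof (rule card_inj_on_le[of "\<lambda>(x, Q, R). x # Q @ R"])
    show "inj_on (\<lambda>(x, Q, R). x # Q @ R) ?D"
      by (fastforce simp: inj_on_def swaps_def tuples_def)
    show "(\<lambda>(x, Q, R). x # Q @ R) ` ?D \<subseteq> swaps (Suc (t + u)) M N"
      using Cons_append_in_swaps by fastforce
  qed (rule finite_swaps)
  finally show ?thesis .
qed

text \<open>A bound on a sum over all partners, because the density hypothesis speaks of such sums;
  \<open>sum_markov\<close> turns a large sum into many partners.\<close>

definition bad :: "nat \<Rightarrow> real \<Rightarrow> 'a set" where
  "bad s \<gamma> = {b \<in> V. (\<Sum>v\<in>V. real (card (swaps s {#b#} {#v#}))) < \<gamma> * real (card V) ^ Suc s}"

text \<open>Otherwise the bad set is large enough to play the role of \<open>X\<close> against all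
  of \<open>V\<close>, although each of its vertices contributes too little.\<close>

lemma card_bad:
  fixes \<beta> \<gamma> :: real
  assumes dense: "\<And>X. X \<subseteq> V \<Longrightarrow> real (card X) \<ge> \<beta> * card V \<Longrightarrow>
      (\<Sum>x\<in>X. \<Sum>y\<in>V. real (card (swaps s {#x#} {#y#}))) \<ge> \<gamma> * real (card V) ^ (s + 2)"
    and "V \<noteq> {}" "\<beta> > 0" "\<gamma> > 0"
  shows "real (card (bad s \<gamma>)) < \<beta> * card V"
proof (rule ccontr)
  let ?n = "real (card V)"
  assume "\<not> ?thesis"
  then have ge: "real (card (bad s \<gamma>)) \<ge> \<beta> * ?n" by simp
  have n: "?n > 0" using finite_V \<open>V \<noteq> {}\<close> by (simp add: card_gt_0_iff)
  have fin: "finite (bad s \<gamma>)" and sub: "bad s \<gamma> \<subseteq> V" using finite_V by (auto simp: bad_def)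
  have "bad s \<gamma> \<noteq> {}" using ge mult_pos_pos[OF \<open>\<beta> > 0\<close> n] by (intro notI) simp
  have "\<gamma> * ?n ^ (s + 2) \<le> (\<Sum>x\<in>bad s \<gamma>. \<Sum>y\<in>V. real (card (swaps s {#x#} {#y#})))"
    by (rule dense[OF sub ge])
  also have "\<dots> < (\<Sum>x\<in>bad s \<gamma>. \<gamma> * ?n ^ Suc s)"
    using fin \<open>bad s \<gamma> \<noteq> {}\<close> by (intro sum_strict_mono) (auto simp: bad_def)
  also have "\<dots> = real (card (bad s \<gamma>)) * (\<gamma> * ?n ^ Suc s)" by simp
  also have "\<dots> \<le> ?n * (\<gamma> * ?n ^ Suc s)"
    using \<open>\<gamma> > 0\<close> card_mono[OF finite_V sub] by (intro mult_right_mono) auto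
  finally show False by (simp add: algebra_simps)
qed

text \<open>Each of \<open>u\<close> and \<open>v\<close> has at least \<gamma>/2 * n partners with
  at least \<gamma>/2 * n^s exchanges each, and the hypothesis applies to the two sets of partners.
  Three exchanges and two middle vertices make up the length 3 * s + 2.\<close>

lemma card_swaps_good:
  fixes \<gamma> \<delta> :: real
  assumes dense: "\<And>X Y. X \<subseteq> V \<Longrightarrow> Y \<subseteq> V \<Longrightarrow> real (card X) \<ge> \<gamma> / 2 * card V \<Longrightarrow>
      real (card Y) \<ge> \<gamma> / 2 * card V \<Longrightarrow>
      (\<Sum>x\<in>X. \<Sum>y\<in>Y. real (card (swaps s {#x#} {#y#}))) \<ge> \<delta> * real (card V) ^ (s + 2)"
    and "\<gamma> > 0" and u: "u \<in> V - bad s \<gamma>" and v: "v \<in> V - bad s \<gamma>"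
  shows "real (card (swaps (3 * s + 2) {#u#} {#v#}))
    \<ge> (\<gamma> / 2)\<^sup>2 * \<delta> * real (card V) ^ (3 * s + 2)"
proof -
  let ?n = "real (card V)"
  let ?c = "\<lambda>x y. real (card (swaps s {#x#} {#y#}))"
  let ?X = "\<lambda>u. {x \<in> V. ?c u x \<ge> \<gamma> / 2 * ?n ^ s}"
  have n: "?n > 0" using finite_V u by (auto simp: card_gt_0_iff)
  have X: "real (card (?X w)) \<ge> \<gamma> / 2 * ?n" if "w \<in> V - bad s \<gamma>" for w
  proof (rule sum_markov[OF finite_V refl n])
    show "?c w x \<le> ?n ^ s" for x
      using card_swaps_le by (metis of_nat_mono of_nat_power)
    show "\<gamma> * (?n * ?n ^ s) \<le> (\<Sum>x\<in>V. ?c w x)"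
      using that by (auto simp: bad_def not_less)
  qed (use n \<open>\<gamma> > 0\<close> in auto)
  define A where "A = \<gamma> / 2 * ?n ^ s"
  have A: "A \<ge> 0" using \<open>\<gamma> > 0\<close> n by (simp add: A_def)
  have "(\<gamma> / 2)\<^sup>2 * \<delta> * ?n ^ (3 * s + 2) = A * (A * (\<delta> * ?n ^ (s + 2)))"
    by (simp add: A_def power2_eq_square power_add mult_2 numeral_3_eq_3 ac_simps)
  also have "\<dots> \<le> A * (A * (\<Sum>x\<in>?X u. \<Sum>y\<in>?X v. ?c x y))"
    using dense[of "?X u" "?X v"] X[OF u] X[OF v] A by (intro mult_left_mono) auto
  also have "\<dots> = (\<Sum>x\<in>?X u. \<Sum>y\<in>?X v. A * (?c x y * A))"
    by (simp add: sum_distrib_left ac_simps)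
  also have "\<dots> \<le> (\<Sum>x\<in>?X u. \<Sum>y\<in>?X v. ?c u x * (?c x y * ?c y v))"
    using A by (intro sum_mono mult_mono) (auto simp: A_def swaps_sym[of s _ "{#v#}"])
  also have "\<dots> \<le> (\<Sum>x\<in>V. \<Sum>y\<in>V. ?c u x * (?c x y * ?c y v))"
    using finite_V by (intro order_trans[OF sum_mono sum_mono2] sum_mono2) (auto intro!: sum_nonneg)
  also have "\<dots> = (\<Sum>x\<in>V. ?c u x * (\<Sum>y\<in>V. ?c x y * ?c y v))"
    by (simp add: sum_distrib_left)
  also have "\<dots> \<le> (\<Sum>x\<in>V. ?c u x * real (card (swaps (Suc (s + s)) {#x#} {#v#})))"
    using of_nat_mono[OF card_swaps_chain, where 'a = real] by (intro sum_mono mult_left_mono) (simp_all only: of_nat_sum of_nat_mult of_nat_0_le_iff)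
  also have "\<dots> \<le> real (card (swaps (Suc (s + Suc (s + s))) {#u#} {#v#}))"
    using of_nat_mono[OF card_swaps_chain, where 'a = real, of s "{#u#}" "Suc (s + s)" "{#v#}"]
    by (simp only: of_nat_sum of_nat_mult)
  also have "Suc (s + Suc (s + s)) = 3 * s + 2" by simp
  finally show ?thesis .
qed

text \<open>The entries are exchanged independently, each with its own block of length
  \<open>t\<close>, so the densities multiply.\<close>

lemma card_swaps_mset:
  fixes \<gamma> :: real
  assumes "\<And>u v. u \<in> G \<Longrightarrow> v \<in> G \<Longrightarrow> real (card (swaps t {#u#} {#v#})) \<ge> \<gamma> * real (card V) ^ t"
    and "\<gamma> \<ge> 0" "set us \<subseteq> G" "set vs \<subseteq> G" "length us = length vs"
  shows "real (card (swaps (length us * t) (mset us) (mset vs)))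
    \<ge> \<gamma> ^ length us * real (card V) ^ (length us * t)"
  using assms(5,3,4)
proof (induction us vs rule: list_induct2)
  case Nil
  have "swaps 0 {#} {#} = {[]}"
    by (auto simp: swaps_def tuples_0 tileable_empty)
  then show ?case by simp
next
  case (Cons u us v vs)
  then have "real (card (swaps (t + length us * t) ({#u#} + mset us) ({#v#} + mset vs)))
      \<ge> \<gamma> * \<gamma> ^ length us * real (card V) ^ (t + length us * t)"
    using assms(1,2) by (intro card_swaps_add) auto
  then show ?case by simp
qed

section \<open>Absorbing tuples\<close>

definition absorbers :: "nat \<Rightarrow> 'a multiset \<Rightarrow> 'a list set" where
  "absorbers k M = {A \<in> tuples V k. tileable (mset A) \<and> tileable (M + mset A)}"

text \<open>An absorber is a tile \<open>xs\<close> of good vertices followed by a tuple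
  \<open>Q\<close> that exchanges \<open>D\<close> for \<open>xs\<close>. Without \<open>D\<close>,
  the tuple \<open>Q\<close> is tiled together with \<open>xs\<close>; with \<open>D\<close>, it is
  tiled together with \<open>D\<close>, and \<open>xs\<close> stands as a tile of its own.\<close>

lemma card_absorbers:
  fixes \<gamma> h :: real
  assumes G: "G \<subseteq> V"
    and swap: "\<And>u v. u \<in> G \<Longrightarrow> v \<in> G \<Longrightarrow> real (card (swaps t {#u#} {#v#})) \<ge> \<gamma> * real (card V) ^ t"
    and tiles: "real (card {xs \<in> tuples G (Suc r). tile (mset xs)}) \<ge> h * real (card V) ^ Suc r"
    and D: "D \<in> tuples G (Suc r)" and "\<gamma> \<ge> 0"
  shows "real (card (absorbers (Suc r + Suc r * t) (mset D)))
    \<ge> h * \<gamma> ^ Suc r * real (card V) ^ (Suc r + Suc r * t)"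
proof (rule card_append_ge[OF _ _ _ tiles])
  show "finite {xs \<in> tuples G (Suc r). tile (mset xs)}"
    using finite_tuples[OF finite_subset[OF G finite_V]] by simp
  show fin: "finite (absorbers (Suc r + Suc r * t) (mset D))"
    unfolding absorbers_def using finite_tuples[OF finite_V] by simp
  fix xs assume xs: "xs \<in> {xs \<in> tuples G (Suc r). tile (mset xs)}"
  then show "length xs = Suc r" by (simp add: tuples_def)
  let ?Y = "{ys. xs @ ys \<in> absorbers (Suc r + Suc r * t) (mset D)}"
  have "finite ?Y"
    by (rule finite_imageD[of "\<lambda>ys. xs @ ys"])
      (auto intro: finite_subset[OF _ fin] simp: inj_on_def)
  moreover have "swaps (Suc r * t) (mset D) (mset xs) \<subseteq> ?Y"
  proof
    fix Q assume Q: "Q \<in> swaps (Suc r * t) (mset D) (mset xs)"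
    have "tileable (mset xs + (mset D + mset Q))"
      by (rule tileable_add) (use xs Q in \<open>auto simp: swaps_def tileable_tile\<close>)
    moreover have "xs @ Q \<in> tuples V (Suc r + Suc r * t)"
      using xs Q tuples_mono[OF G] by (intro append_in_tuples) (auto simp: swaps_def)
    ultimately show "Q \<in> ?Y"
      using Q by (auto simp: absorbers_def swaps_def ac_simps)
  qed
  ultimately have "card (swaps (Suc r * t) (mset D) (mset xs)) \<le> card ?Y"
    by (rule card_mono)
  moreover have "real (card (swaps (Suc r * t) (mset D) (mset xs)))
      \<ge> \<gamma> ^ Suc r * real (card V) ^ (Suc r * t)"
    using card_swaps_mset[OF swap, of G D xs] assms xs by (auto simp: tuples_def)
  ultimately show "\<gamma> ^ Suc r * real (card V) ^ (Suc r * t) \<le> real (card ?Y)"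
    by linarith
qed (use \<open>\<gamma> \<ge> 0\<close> in auto)

end

section \<open>Absorption\<close>

text \<open>The tuples are chosen one at a time, each disjoint from the previous ones, so as not to exceed the
  average of the potential \<open>\<Sum>D. 2 ^ (- number of chosen tuples serving D)\<close>.\<close>

lemma select_disjoint_tuples:
  fixes \<A> :: "'d \<Rightarrow> 'a list set" and \<gamma> :: real
  assumes V: "finite V" "V \<noteq> {}" and \<P>: "\<P> \<subseteq> tuples V K" and "K > 0" and \<D>: "finite \<D>"
    and \<A>: "\<And>D. D \<in> \<D> \<Longrightarrow> \<A> D \<subseteq> \<P>"
    and dense: "\<And>D. D \<in> \<D> \<Longrightarrow> real (card (\<A> D)) \<ge> \<gamma> * real (card V) ^ K"
    and "\<gamma> > 0" and m: "2 * (real K)\<^sup>2 * real m \<le> \<gamma> * real (card V)"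
  shows "\<exists>\<C>\<subseteq>\<P>. card \<C> \<le> m \<and> (\<forall>A\<in>\<C>. \<forall>B\<in>\<C>. A \<noteq> B \<longrightarrow> set A \<inter> set B = {}) \<and>
    (\<Sum>D\<in>\<D>. (1 / 2) ^ card (\<C> \<inter> \<A> D)) \<le> real (card \<D>) * (1 - \<gamma> / 4) ^ m"
  using m
proof (induction m)
  case 0
  then show ?case by (intro exI[of _ "{}"]) simp
next
  case (Suc m)
  let ?n = "real (card V)"
  have n: "?n > 0" using V by (simp add: card_gt_0_iff)
  have fin\<P>: "finite \<P>" using finite_subset[OF \<P> finite_tuples[OF V(1)]] .
  have "2 * (real K)\<^sup>2 * real m \<le> 2 * (real K)\<^sup>2 * real (Suc m)"
    by (intro mult_left_mono) auto
  then obtain \<C> where \<C>: "\<C> \<subseteq> \<P>" "card \<C> \<le> m"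
      "\<forall>A\<in>\<C>. \<forall>B\<in>\<C>. A \<noteq> B \<longrightarrow> set A \<inter> set B = {}"
    and pot: "(\<Sum>D\<in>\<D>. (1 / 2) ^ card (\<C> \<inter> \<A> D)) \<le> real (card \<D>) * (1 - \<gamma> / 4) ^ m"
    using Suc by (meson order_trans)
  have fin\<C>: "finite \<C>" using finite_subset[OF \<C>(1) fin\<P>] .
  show ?case
  proof (cases "\<D> = {}")
    case True
    then show ?thesis by (intro exI[of _ "{}"]) simp
  next
    case False
    define Z where "Z = (\<Union>A\<in>\<C>. set A)"
    define \<Q> where "\<Q> = {A \<in> \<P>. set A \<inter> Z = {}}"
    define w where "w D = (1 / 2 :: real) ^ card (\<C> \<inter> \<A> D)" for D
    have fin: "finite Z" "finite \<Q>" using fin\<C> fin\<P> by (auto simp: Z_def \<Q>_def)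
    have "card Z \<le> (\<Sum>A\<in>\<C>. card (set A))" unfolding Z_def by (rule card_UN_le[OF fin\<C>])
    also have "\<dots> \<le> (\<Sum>A\<in>\<C>. K)"
      using \<C>(1) \<P> by (intro sum_mono) (auto simp: tuples_def intro: order_trans[OF card_length])
    also have "\<dots> \<le> m * K" using \<C>(2) by simp
    finally have Z: "card Z \<le> m * K" .
    have Qle: "real (card \<Q>) \<le> ?n ^ K"
      using card_mono[OF finite_tuples[OF V(1)], of \<Q> K] \<P>
      by (auto simp: \<Q>_def card_tuples[OF V(1)] simp flip: of_nat_power)
    \<comment> \<open>Disjointness costs at most half of the tuples serving \<open>D\<close>: the
      chosen ones cover at most m * K vertices, which the bound on \<open>m\<close> keeps
      small.\<close>
    have hit: "real (card (\<A> D \<inter> \<Q>)) \<ge> \<gamma> / 2 * ?n ^ K" if D: "D \<in> \<D>" for D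
    proof -
      let ?M = "{xs \<in> tuples V K. set xs \<inter> Z \<noteq> {}}"
      have "real (card ?M) * ?n \<le> real K * real (card Z) * ?n ^ K"
        using of_nat_mono[OF card_tuples_meeting[OF V(1) fin(1), of K], where 'a = real] by simp
      also have "\<dots> \<le> real K * (real m * real K) * ?n ^ K"
        using Z by (intro mult_right_mono mult_left_mono) (simp_all flip: of_nat_mult)
      also have "\<dots> = (real K)\<^sup>2 * real m * ?n ^ K" by (simp add: power2_eq_square)
      also have "\<dots> \<le> \<gamma> / 2 * ?n * ?n ^ K"
      proof (rule mult_right_mono)
        have "2 * (real K)\<^sup>2 * real m \<le> \<gamma> * ?n"
          using Suc.prems by (simp add: algebra_simps) (smt (verit) zero_le_power2)
        then show "(real K)\<^sup>2 * real m \<le> \<gamma> / 2 * ?n" by simp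
      qed simp
      finally have M: "real (card ?M) \<le> \<gamma> / 2 * ?n ^ K" using n by (simp add: field_simps)
      have "\<A> D \<subseteq> (\<A> D \<inter> \<Q>) \<union> ?M"
        using \<A>[OF D] \<P> by (auto simp: \<Q>_def)
      then have "card (\<A> D) \<le> card ((\<A> D \<inter> \<Q>) \<union> ?M)"
        using fin finite_tuples[OF V(1)] by (intro card_mono) auto
      also have "\<dots> \<le> card (\<A> D \<inter> \<Q>) + card ?M" by (rule card_Un_le)
      finally show ?thesis using dense[OF D] M by linarith
    qed
    have "\<Q> \<noteq> {}"
    proof -
      obtain D where "D \<in> \<D>" using False by auto
      then have "real (card (\<A> D \<inter> \<Q>)) > 0"
        using hit[of D] \<open>\<gamma> > 0\<close> n by (smt (verit) divide_pos_pos zero_less_mult_iff zero_less_power)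
      then show ?thesis by auto
    qed
    \<comment> \<open>The potential after adding \<open>A\<close>, which halves the weight of every
      \<open>D\<close> it serves. On average over \<open>\<Q>\<close> a weight loses at least the
      fraction \<gamma>/4, because at least the fraction \<gamma>/2 of \<open>\<Q>\<close> serves
      \<open>D\<close>.\<close>
    let ?\<Phi> = "\<lambda>A. \<Sum>D\<in>\<D>. w D * (1 - 1 / 2 * of_bool (A \<in> \<A> D))"
    have "\<exists>A\<in>\<Q>. ?\<Phi> A \<le> (1 - \<gamma> / 4) * (\<Sum>D\<in>\<D>. w D)"
    proof (rule ccontr)
      assume "\<not> ?thesis"
      then have "(\<Sum>A\<in>\<Q>. (1 - \<gamma> / 4) * (\<Sum>D\<in>\<D>. w D)) < (\<Sum>A\<in>\<Q>. ?\<Phi> A)"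
        using fin \<open>\<Q> \<noteq> {}\<close> by (intro sum_strict_mono) auto
      also have "\<dots> = (\<Sum>D\<in>\<D>. \<Sum>A\<in>\<Q>. w D * (1 - 1 / 2 * of_bool (A \<in> \<A> D)))"
        by (rule sum.swap)
      also have "\<dots> = (\<Sum>D\<in>\<D>. w D * (real (card \<Q>) - 1 / 2 * real (card (\<A> D \<inter> \<Q>))))"
      proof (rule sum.cong[OF refl])
        fix D
        have "(\<Sum>A\<in>\<Q>. of_bool (A \<in> \<A> D)) = real (card (\<A> D \<inter> \<Q>))"
          using fin by (simp add: of_bool_def sum.If_cases Int_def conj_commute)
        then show "(\<Sum>A\<in>\<Q>. w D * (1 - 1 / 2 * of_bool (A \<in> \<A> D)))
            = w D * (real (card \<Q>) - 1 / 2 * real (card (\<A> D \<inter> \<Q>)))"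
          by (simp add: sum_subtractf flip: sum_distrib_left sum_divide_distrib)
      qed
      also have "\<dots> \<le> (\<Sum>D\<in>\<D>. w D * (real (card \<Q>) * (1 - \<gamma> / 4)))"
      proof (intro sum_mono mult_left_mono)
        fix D assume "D \<in> \<D>"
        then have "\<gamma> / 2 * real (card \<Q>) \<le> real (card (\<A> D \<inter> \<Q>))"
          using hit[of D] mult_left_mono[OF Qle, of "\<gamma> / 2"] \<open>\<gamma> > 0\<close> by linarith
        then show "real (card \<Q>) - 1 / 2 * real (card (\<A> D \<inter> \<Q>)) \<le> real (card \<Q>) * (1 - \<gamma> / 4)"
          by (simp add: algebra_simps)
      qed (simp add: w_def)
      also have "\<dots> = (\<Sum>A\<in>\<Q>. (1 - \<gamma> / 4) * (\<Sum>D\<in>\<D>. w D))"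
        by (simp add: ac_simps flip: sum_distrib_right sum_distrib_left)
      finally show False by simp
    qed
    then obtain A where A: "A \<in> \<Q>" and \<Phi>: "?\<Phi> A \<le> (1 - \<gamma> / 4) * (\<Sum>D\<in>\<D>. w D)" by auto
    have disj: "set A \<inter> set B = {}" if "B \<in> \<C>" for B
      using A that by (auto simp: \<Q>_def Z_def)
    \<comment> \<open>An empty tuple would be disjoint from itself, so disjointness alone would not
      show that \<open>A\<close> is new.\<close>
    have "set A \<noteq> {}" using A \<P> \<open>K > 0\<close> by (auto simp: \<Q>_def tuples_def)
    then have new: "A \<notin> \<C>" using disj[of A] by auto
    \<comment> \<open>Leads to \<gamma>/2 \<le> 1, so that 1 - \<gamma>/4 is not negative and the
      bound on the old potential can be multiplied by it.\<close>
    have "real (card (\<A> D \<inter> \<Q>)) \<le> ?n ^ K" for D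
    proof -
      have "card (\<A> D \<inter> \<Q>) \<le> card \<Q>" using fin(2) by (intro card_mono) auto
      then show ?thesis using Qle by linarith
    qed
    moreover obtain D0 where "D0 \<in> \<D>" using False by auto
    ultimately have "\<gamma> / 2 * ?n ^ K \<le> 1 * ?n ^ K"
      using hit[of D0] by (metis mult_1 order_trans)
    then have \<gamma>: "\<gamma> / 2 \<le> 1" using n by (simp only: mult_le_cancel_right_pos zero_less_power)
    have w': "(1 / 2) ^ card (insert A \<C> \<inter> \<A> D) = w D * (1 - 1 / 2 * of_bool (A \<in> \<A> D))" for D
      using new fin\<C> by (simp add: w_def Int_insert_left)
    have "(\<Sum>D\<in>\<D>. (1 / 2) ^ card (insert A \<C> \<inter> \<A> D)) = ?\<Phi> A"
      by (simp only: w')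
    also have "\<dots> \<le> (1 - \<gamma> / 4) * (\<Sum>D\<in>\<D>. w D)" by (rule \<Phi>)
    also have "\<dots> \<le> (1 - \<gamma> / 4) * (real (card \<D>) * (1 - \<gamma> / 4) ^ m)"
      using pot \<gamma> by (intro mult_left_mono) (auto simp: w_def)
    finally have "(\<Sum>D\<in>\<D>. (1 / 2) ^ card (insert A \<C> \<inter> \<A> D)) \<le> real (card \<D>) * (1 - \<gamma> / 4) ^ Suc m"
      by (simp only: power_Suc mult.left_commute)
    moreover have "insert A \<C> \<subseteq> \<P>" using A \<C>(1) by (auto simp: \<Q>_def)
    moreover have "card (insert A \<C>) \<le> Suc m" using \<C>(2) new fin\<C> by simp
    ultimately show ?thesis
      using disj \<C>(3) by (intro exI[of _ "insert A \<C>"]) blast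
  qed
qed

section \<open>From disjoint absorbers to a perfect packing\<close>

context tile_system
begin

lemma packable_UN:
  assumes "finite \<C>" "\<And>A. A \<in> \<C> \<Longrightarrow> packable (set A)"
    and "\<And>A B. A \<in> \<C> \<Longrightarrow> B \<in> \<C> \<Longrightarrow> A \<noteq> B \<Longrightarrow> set A \<inter> set B = {}"
  shows "packable (\<Union>A\<in>\<C>. set A)"
  using assms
proof (induction \<C>)
  case empty
  then show ?case by (simp add: packable_empty)
next
  case (insert A \<C>)
  have "packable (\<Union>B\<in>\<C>. set B)" using insert.prems by (intro insert.IH) auto
  moreover have "set A \<inter> (\<Union>B\<in>\<C>. set B) = {}" using insert.prems(2) insert.hyps(2) by blast
  ultimately show ?case using insert.prems(1)[of A] packable_Un[of "set A"] by simp
qed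

text \<open>Each tile-sized piece of \<open>W\<close> uses up one absorber, which lowers the supply
  for any other piece by at most one; so j absorbers for every tuple suffice for j pieces. Absorbers
  left over are packed on their own.\<close>

lemma packable_absorb:
  assumes "finite \<C>" "\<And>A. A \<in> \<C> \<Longrightarrow> distinct A \<and> tileable (mset A)"
    and "\<And>A B. A \<in> \<C> \<Longrightarrow> B \<in> \<C> \<Longrightarrow> A \<noteq> B \<Longrightarrow> set A \<inter> set B = {}"
    and "\<And>D. D \<in> tuples G (Suc r) \<Longrightarrow> j \<le> card (\<C> \<inter> absorbers k (mset D))"
    and "W \<subseteq> G" "finite W" "card W = Suc r * j" "W \<inter> (\<Union>A\<in>\<C>. set A) = {}"
  shows "packable (W \<union> (\<Union>A\<in>\<C>. set A))"
  using assms
proof (induction j arbitrary: \<C> W)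
  case 0
  then have "W = {}" by simp
  then show ?case
    using packable_UN[of \<C>] 0(1-3) packable_set by auto
next
  case (Suc j)
  have "Suc r \<le> card W" using Suc.prems(7) by simp
  then obtain W' where W': "W' \<subseteq> W" "card W' = Suc r" by (meson obtain_subset_with_card_n)
  then have "finite W'" using Suc.prems(6) by (meson finite_subset)
  then obtain D where D: "set D = W'" "distinct D" using finite_distinct_list by auto
  have "D \<in> tuples G (Suc r)"
    using D W' Suc.prems(5) distinct_card[OF D(2)] by (auto simp: tuples_def)
  then have hits: "Suc j \<le> card (\<C> \<inter> absorbers k (mset D))" by (rule Suc.prems(4))
  then have "\<C> \<inter> absorbers k (mset D) \<noteq> {}" by (intro notI) simp
  then obtain A where A: "A \<in> \<C>" "A \<in> absorbers k (mset D)" by blast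
  let ?\<C> = "\<C> - {A}"
  have "packable ((W - W') \<union> (\<Union>B\<in>?\<C>. set B))"
  proof (rule Suc.IH)
    show "j \<le> card (?\<C> \<inter> absorbers k (mset D'))" if "D' \<in> tuples G (Suc r)" for D'
    proof -
      have "?\<C> \<inter> absorbers k (mset D') = (\<C> \<inter> absorbers k (mset D')) - {A}" by auto
      then show ?thesis
        using Suc.prems(4)[OF that] diff_card_le_card_Diff[of "{A}" "\<C> \<inter> absorbers k (mset D')"]
        by simp
    qed
    show "card (W - W') = Suc r * j"
      using W' Suc.prems(7) \<open>finite W'\<close> by (simp add: card_Diff_subset)
  qed (use Suc.prems in auto)
  moreover have "packable (set (D @ A))"
  proof (rule packable_set)
    show "tileable (mset (D @ A))" using A(2) by (simp add: absorbers_def)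
    have "W' \<inter> set A = {}" using Suc.prems(8) A(1) W'(1) by blast
    then show "distinct (D @ A)" using D Suc.prems(2)[OF A(1)] by simp
  qed
  moreover have "((W - W') \<union> (\<Union>B\<in>?\<C>. set B)) \<inter> set (D @ A) = {}"
  proof -
    have "(\<Union>B\<in>?\<C>. set B) \<inter> set A = {}" using Suc.prems(3)[OF _ A(1)] by blast
    moreover have "W \<inter> (\<Union>B\<in>?\<C>. set B) = {}" "W \<inter> set A = {}" using Suc.prems(8) A(1) by blast+
    ultimately show ?thesis using W'(1) D(1) unfolding set_append by blast
  qed
  moreover have "((W - W') \<union> (\<Union>B\<in>?\<C>. set B)) \<union> set (D @ A) = W \<union> (\<Union>B\<in>\<C>. set B)"
    using D(1) W'(1) A(1) by auto
  ultimately show ?case using packable_Un by fastforce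
qed

lemma packable_almost_all:
  assumes "finite U"
    and "\<And>X. X \<subseteq> U \<Longrightarrow> \<kappa> \<le> real (card X) \<Longrightarrow> \<exists>xs. distinct xs \<and> set xs \<subseteq> X \<and> tile (mset xs)"
  shows "\<exists>W\<subseteq>U. real (card W) < \<kappa> \<and> packable (U - W)"
  using assms
proof (induction U rule: finite_psubset_induct)
  case (psubset U)
  show ?case
  proof (cases "real (card U) < \<kappa>")
    case True
    then show ?thesis by (intro exI[of _ U]) (simp add: packable_empty)
  next
    case False
    then obtain xs where xs: "distinct xs" "set xs \<subseteq> U" "tile (mset xs)"
      using psubset.prems[of U] by auto
    have "hd xs \<in> set xs" using size_tile[OF xs(3)] by (cases xs) auto
    then have "U - set xs \<subset> U" using xs(2) by blast
    moreover have "\<exists>xs. distinct xs \<and> set xs \<subseteq> X \<and> tile (mset xs)"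
      if "X \<subseteq> U - set xs" "\<kappa> \<le> real (card X)" for X
      using psubset.prems[of X] that by auto
    ultimately obtain W where W: "W \<subseteq> U - set xs" "real (card W) < \<kappa>" "packable (U - set xs - W)"
      using psubset.IH[of "U - set xs"] by meson
    have "packable ((U - set xs - W) \<union> set xs)"
      by (intro packable_Un W packable_set tileable_tile xs) auto
    also have "(U - set xs - W) \<union> set xs = U - W" using xs(2) W(1) by auto
    finally show ?thesis using W by auto
  qed
qed

text \<open>Greedy: a vertex of \<open>B\<close> outside \<open>A\<close> and outside the earlier
  tiles gets a tile of its own. The last hypothesis keeps the tuples that meet used vertices or
  repeat an entry below the number of tiles through the vertex.\<close>

lemma packable_cover:
  fixes c :: real
  assumes "finite B" "B \<subseteq> V" "finite A"
    and dense: "\<And>w. w \<in> V \<Longrightarrow>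
      real (card {Q \<in> tuples V r. tile (add_mset w (mset Q))}) \<ge> c * real (card V) ^ r"
    and "real r * (real (card A) + real (Suc r) * real (card B) + 1) + (real r)\<^sup>2 < c * real (card V)"
  shows "\<exists>U\<subseteq>V. B - A \<subseteq> U \<and> U \<inter> A = {} \<and> card U \<le> Suc r * card B \<and> packable U"
  using assms(1,2,5)
proof (induction B)
  case empty
  then show ?case by (intro exI[of _ "{}"]) (simp add: packable_empty)
next
  case (insert b B)
  let ?n = "real (card V)"
  have "real r * (real (card A) + real (Suc r) * real (card B) + 1)
      \<le> real r * (real (card A) + real (Suc r) * real (card (insert b B)) + 1)"
    using insert.hyps by (intro mult_left_mono add_mono) auto
  then have small: "real r * (real (card A) + real (Suc r) * real (card B) + 1) + (real r)\<^sup>2 < c * ?n"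
    using insert.prems(2) by linarith
  obtain U where U: "U \<subseteq> V" "B - A \<subseteq> U" "U \<inter> A = {}" "card U \<le> Suc r * card B" "packable U"
    using insert.IH[OF _ small] insert.prems(1) by auto
  show ?case
  proof (cases "b \<in> A \<union> U")
    case True
    then show ?thesis using U insert.hyps by (intro exI[of _ U]) auto
  next
    case False
    have finU: "finite U" using U(1) finite_V finite_subset by auto
    \<comment> \<open>The vertex \<open>b\<close> itself is to be avoided too, as the tile through
      it must be genuine; this is the 1 in the size bound.\<close>
    let ?Z = "insert b (A \<union> U)"
    have "card ?Z \<le> Suc (card (A \<union> U))" by (rule card_insert_le_m1) simp_all
    also have "\<dots> \<le> card A + Suc r * card B + 1" using card_Un_le[of A U] U(4) by simp
    finally have "real (card ?Z) \<le> real (card A) + real (Suc r) * real (card B) + 1"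
      by (metis (no_types) of_nat_1 of_nat_add of_nat_le_iff of_nat_mult)
    then have "real r * real (card ?Z) \<le> real r * (real (card A) + real (Suc r) * real (card B) + 1)"
      by (rule mult_left_mono) simp
    then have "real r * real (card ?Z) + (real r)\<^sup>2 < c * ?n" using small by linarith
    moreover have "b \<in> V" using insert.prems by simp
    ultimately obtain Q where Q: "Q \<in> {Q \<in> tuples V r. tile (add_mset b (mset Q))}"
        "distinct Q" "set Q \<inter> ?Z = {}"
      using ex_distinct_avoiding[OF finite_V _ _ _ dense[of b], of ?Z] \<open>finite A\<close> finU by auto
    have "packable (set (b # Q))"
      using Q by (intro packable_set tileable_tile) auto
    then have "packable (U \<union> set (b # Q))"
      using False Q by (intro packable_Un U) auto
    moreover have "card (U \<union> set (b # Q)) \<le> card U + card (set (b # Q))"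
      by (rule card_Un_le)
    moreover have "card (set (b # Q)) \<le> Suc r"
      using Q(1) card_length[of "b # Q"] by (simp add: tuples_def)
    moreover have "U \<union> set (b # Q) \<subseteq> V" "insert b B - A \<subseteq> U \<union> set (b # Q)"
        "(U \<union> set (b # Q)) \<inter> A = {}"
      using U Q False \<open>b \<in> V\<close> by (auto simp: tuples_def)
    ultimately show ?thesis
      using U(4) insert.hyps by (intro exI[of _ "U \<union> set (b # Q)"]) auto
  qed
qed

text \<open>The absorbing set is chosen before the bad vertices are covered. It may contain bad
  vertices, which is harmless since it is packable by itself. Only \<open>B - A\<close> is left to
  cover, and the final leftover consists of good vertices, for which the absorbers are made.\<close>

lemma packable_V:
  fixes \<beta> \<gamma> \<delta> c h h' \<kappa> :: real and s m :: nat
  defines "n \<equiv> real (card V)"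
    and "t \<equiv> 3 * s + 2"
    and "K \<equiv> Suc r + Suc r * (3 * s + 2)"
    and "\<eta> \<equiv> h * ((\<gamma> / 2)\<^sup>2 * \<delta>) ^ Suc r"
  assumes "V \<noteq> {}" and pos: "\<beta> > 0" "\<beta> \<le> 1 / 2" "\<gamma> > 0" "\<delta> > 0" "h > 0"
    and swap_bad: "\<And>X. X \<subseteq> V \<Longrightarrow> real (card X) \<ge> \<beta> * n \<Longrightarrow>
      (\<Sum>x\<in>X. \<Sum>y\<in>V. real (card (swaps s {#x#} {#y#}))) \<ge> \<gamma> * n ^ (s + 2)"
    and swap_good: "\<And>X Y. X \<subseteq> V \<Longrightarrow> Y \<subseteq> V \<Longrightarrow> real (card X) \<ge> \<gamma> / 2 * n \<Longrightarrow>
      real (card Y) \<ge> \<gamma> / 2 * n \<Longrightarrow>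
      (\<Sum>x\<in>X. \<Sum>y\<in>Y. real (card (swaps s {#x#} {#y#}))) \<ge> \<delta> * n ^ (s + 2)"
    and tile_at: "\<And>w. w \<in> V \<Longrightarrow> real (card {Q \<in> tuples V r. tile (add_mset w (mset Q))}) \<ge> c * n ^ r"
    and tiles_half: "\<And>X. X \<subseteq> V \<Longrightarrow> real (card X) \<ge> 1 / 2 * n \<Longrightarrow>
      real (card {xs \<in> tuples X (Suc r). tile (mset xs)}) \<ge> h * n ^ Suc r"
    and tiles_in: "\<And>X. X \<subseteq> V \<Longrightarrow> real (card X) \<ge> \<kappa> * n \<Longrightarrow>
      real (card {xs \<in> tuples X (Suc r). tile (mset xs)}) \<ge> h' * n ^ Suc r"
    and n1: "(real (Suc r))\<^sup>2 < h' * n"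
    and n2: "2 * (real K)\<^sup>2 \<le> \<eta> * n"
    and m: "4 * (real K)\<^sup>2 * real m \<le> \<eta> * n"
    and n3: "real r * (real K * real m + real (Suc r) * (\<beta> * n) + 1) + (real r)\<^sup>2 < c * n"
    and n4: "n ^ Suc r * exp (- (\<eta> / 8) * real m) \<le> (1 / 2) powr (\<kappa> * n)"
    and dvd: "Suc r dvd card V"
  shows "packable V"
proof -
  have n: "n > 0" using finite_V \<open>V \<noteq> {}\<close> by (simp add: n_def card_gt_0_iff)
  define B where "B = bad s \<gamma>"
  define G where "G = V - B"
  have BV: "B \<subseteq> V" and GV: "G \<subseteq> V" by (auto simp: B_def bad_def G_def)
  have finB: "finite B" using BV finite_V finite_subset by auto
  have cardB: "real (card B) < \<beta> * n"
    unfolding B_def n_def using swap_bad \<open>V \<noteq> {}\<close> pos unfolding n_def by (intro card_bad) auto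
  have "real (card G) = n - real (card B)"
    unfolding G_def n_def using BV finB finite_V by (simp add: card_Diff_subset card_mono)
  moreover have "\<beta> * n \<le> 1 / 2 * n" using pos(2) n by (intro mult_right_mono) auto
  ultimately have cardG: "real (card G) \<ge> 1 / 2 * n" using cardB by linarith
  have swaps: "real (card (swaps t {#u#} {#v#})) \<ge> (\<gamma> / 2)\<^sup>2 * \<delta> * n ^ t" if "u \<in> G" "v \<in> G" for u v
    unfolding n_def t_def using swap_good that \<open>\<gamma> > 0\<close> unfolding n_def G_def B_def
    by (intro card_swaps_good) auto
  have \<eta>: "\<eta> > 0" using pos by (simp add: \<eta>_def)
  define \<P> where "\<P> = {A \<in> tuples V K. distinct A \<and> tileable (mset A)}"
  \<comment> \<open>Only duplicate-free absorbers can be packed; by \<open>n2\<close> the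
    restriction loses at most half of the count.\<close>
  define \<A> where "\<A> D = {A \<in> absorbers K (mset D). distinct A}" for D
  have \<A>: "real (card (\<A> D)) \<ge> \<eta> / 2 * real (card V) ^ K" if D: "D \<in> tuples G (Suc r)" for D
  proof -
    have "real (card (absorbers K (mset D))) \<ge> \<eta> * n ^ K"
      unfolding \<eta>_def K_def n_def
      using swaps tiles_half[OF GV cardG] pos unfolding n_def t_def
      by (intro card_absorbers[OF GV _ _ D]) auto
    moreover have "absorbers K (mset D) \<subseteq> \<A> D \<union> {xs \<in> tuples V K. \<not> distinct xs}"
      by (auto simp: \<A>_def absorbers_def)
    then have "card (absorbers K (mset D)) \<le> card (\<A> D \<union> {xs \<in> tuples V K. \<not> distinct xs})"
      using finite_tuples[OF finite_V] by (intro card_mono) (auto simp: \<A>_def absorbers_def)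
    then have "card (absorbers K (mset D)) \<le> card (\<A> D) + card {xs \<in> tuples V K. \<not> distinct xs}"
      using card_Un_le order_trans by blast
    moreover have "real (card {xs \<in> tuples V K. \<not> distinct xs}) \<le> \<eta> / 2 * n ^ K"
    proof -
      have "real (card {xs \<in> tuples V K. \<not> distinct xs}) * n \<le> (real K)\<^sup>2 * n ^ K"
        unfolding n_def
        using of_nat_mono[OF card_tuples_not_distinct[OF finite_V, of K], where 'a = real] by simp
      also have "\<dots> \<le> (\<eta> / 2 * n) * n ^ K"
        using n2 n by (intro mult_right_mono) auto
      finally show ?thesis using n by (simp add: field_simps)
    qed
    ultimately show ?thesis unfolding n_def by linarith
  qed
  have "\<exists>\<C>\<subseteq>\<P>. card \<C> \<le> m \<and> (\<forall>A\<in>\<C>. \<forall>B\<in>\<C>. A \<noteq> B \<longrightarrow> set A \<inter> set B = {}) \<and>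
    (\<Sum>D\<in>tuples G (Suc r). (1 / 2) ^ card (\<C> \<inter> \<A> D))
      \<le> real (card (tuples G (Suc r))) * (1 - (\<eta> / 2) / 4) ^ m"
  proof (rule select_disjoint_tuples[OF finite_V \<open>V \<noteq> {}\<close> _ _ _ _ \<A>])
    show "2 * (real K)\<^sup>2 * real m \<le> \<eta> / 2 * real (card V)" using m by (simp add: n_def)
    show "\<A> D \<subseteq> \<P>" for D by (auto simp: \<A>_def \<P>_def absorbers_def)
    show "finite (tuples G (Suc r))" using finite_tuples finite_subset[OF GV finite_V] by auto
  qed (use \<eta> in \<open>auto simp: \<P>_def K_def\<close>)
  then obtain \<C> where \<C>: "\<C> \<subseteq> \<P>" "card \<C> \<le> m"
      "\<And>A B. A \<in> \<C> \<Longrightarrow> B \<in> \<C> \<Longrightarrow> A \<noteq> B \<Longrightarrow> set A \<inter> set B = {}"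
    and pot: "(\<Sum>D\<in>tuples G (Suc r). (1 / 2) ^ card (\<C> \<inter> \<A> D))
      \<le> real (card (tuples G (Suc r))) * (1 - \<eta> / 8) ^ m"
    by auto
  have fin\<C>: "finite \<C>"
    using finite_subset[OF \<C>(1)] finite_tuples[OF finite_V] by (simp add: \<P>_def)
  \<comment> \<open>Makes 1 - \<eta>/8 nonnegative. Tuples in \<open>G\<close> may be degenerate, so
    one good vertex repeated already provides a tuple with many absorbers to compare with the number
    of all tuples.\<close>
  have "\<eta> / 8 \<le> 1"
  proof -
    obtain g where g: "g \<in> G" using cardG n by fastforce
    then have D: "replicate (Suc r) g \<in> tuples G (Suc r)" by (auto simp: tuples_def)
    have "card (\<A> (replicate (Suc r) g)) \<le> card V ^ K"
      unfolding card_tuples[OF finite_V, symmetric]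
      by (intro card_mono finite_tuples finite_V) (auto simp: \<A>_def absorbers_def)
    then have "\<eta> / 2 * n ^ K \<le> 1 * n ^ K"
      using \<A>[OF D] unfolding n_def by (simp flip: of_nat_power)
    then have "\<eta> / 2 \<le> 1" using n by (simp only: mult_le_cancel_right_pos zero_less_power)
    then show ?thesis by simp
  qed
  then have "(1 - \<eta> / 8) ^ m \<ge> 0" by simp
  \<comment> \<open>A single summand is at most the whole potential, which \<open>n4\<close> bounds
    by 2^(-\<kappa> n); hence every tuple has at least \<kappa> n absorbers.\<close>
  have hits: "\<kappa> * n \<le> real (card (\<C> \<inter> absorbers K (mset D)))" if D: "D \<in> tuples G (Suc r)" for D
  proof -
    have finG: "finite G" using finite_subset[OF GV finite_V] .
    have "(1 / 2 :: real) powr real (card (\<C> \<inter> \<A> D)) = (1 / 2) ^ card (\<C> \<inter> \<A> D)"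
      by (simp add: powr_realpow)
    also have "\<dots> \<le> (\<Sum>D\<in>tuples G (Suc r). (1 / 2) ^ card (\<C> \<inter> \<A> D))"
      using D finite_tuples[OF finG] by (intro member_le_sum) auto
    also have "\<dots> \<le> real (card (tuples G (Suc r))) * (1 - \<eta> / 8) ^ m" by (rule pot)
    also have "\<dots> \<le> n ^ Suc r * (1 - \<eta> / 8) ^ m"
      using \<open>(1 - \<eta> / 8) ^ m \<ge> 0\<close> card_mono[OF finite_V GV] unfolding card_tuples[OF finG] n_def of_nat_power
      by (intro mult_right_mono power_mono) auto
    also have "\<dots> \<le> n ^ Suc r * exp (- (\<eta> / 8)) ^ m"
      using \<open>\<eta> / 8 \<le> 1\<close> n exp_ge_add_one_self[of "- (\<eta> / 8)"]
      by (intro mult_left_mono power_mono) auto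
    also have "\<dots> \<le> (1 / 2) powr (\<kappa> * n)"
      using n4 by (simp add: exp_of_nat_mult mult.commute flip: exp_of_nat2_mult)
    finally have "\<kappa> * n \<le> real (card (\<C> \<inter> \<A> D))"
      by (rule contrapos_pp) (use powr_less_mono' in \<open>auto simp: not_le\<close>)
    also have "card (\<C> \<inter> \<A> D) \<le> card (\<C> \<inter> absorbers K (mset D))"
      using fin\<C> by (intro card_mono) (auto simp: \<A>_def)
    finally show ?thesis by simp
  qed
  define A where "A = (\<Union>A\<in>\<C>. set A)"
  have \<C>': "distinct A" "tileable (mset A)" "set A \<subseteq> V" "length A = K" if "A \<in> \<C>" for A
    using \<C>(1) that by (auto simp: \<P>_def tuples_def)
  have A: "finite A" "A \<subseteq> V" using fin\<C> \<C>' by (auto simp: A_def)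
  have "card A \<le> (\<Sum>A\<in>\<C>. card (set A))" unfolding A_def by (rule card_UN_le[OF fin\<C>])
  also have "\<dots> \<le> (\<Sum>A\<in>\<C>. K)"
    using \<C>' by (intro sum_mono) (metis card_length)
  also have "\<dots> \<le> K * m" using \<C>(2) by simp
  finally have cardA: "real (card A) \<le> real K * real m" by (simp flip: of_nat_mult)
  have "\<exists>U\<subseteq>V. B - A \<subseteq> U \<and> U \<inter> A = {} \<and> card U \<le> Suc r * card B \<and> packable U"
  proof (rule packable_cover[OF finB BV A(1)])
    show "c * real (card V) ^ r \<le> real (card {Q \<in> tuples V r. tile (add_mset w (mset Q))})"
      if "w \<in> V" for w using tile_at[OF that] by (simp add: n_def)
    have "real r * (real (card A) + real (Suc r) * real (card B) + 1)
        \<le> real r * (real K * real m + real (Suc r) * (\<beta> * n) + 1)"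
      using cardA cardB by (intro mult_left_mono add_mono) auto
    then show "real r * (real (card A) + real (Suc r) * real (card B) + 1) + (real r)\<^sup>2 < c * real (card V)"
      using n3 by (simp add: n_def)
  qed
  then obtain U where U: "U \<subseteq> V" "B - A \<subseteq> U" "U \<inter> A = {}" "packable U" by auto
  have "\<exists>W\<subseteq>V - A - U. real (card W) < \<kappa> * n \<and> packable (V - A - U - W)"
  proof (rule packable_almost_all)
    fix X assume X: "X \<subseteq> V - A - U" "\<kappa> * n \<le> real (card X)"
    then have "X \<subseteq> V" by auto
    have "{xs \<in> tuples X (Suc r). tile (mset xs)} \<subseteq> tuples V (Suc r)"
      using tuples_mono[OF \<open>X \<subseteq> V\<close>] by auto
    then obtain xs where "xs \<in> {xs \<in> tuples X (Suc r). tile (mset xs)}" "distinct xs"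
      using ex_distinct_avoiding[of V "{}" "{xs \<in> tuples X (Suc r). tile (mset xs)}" "Suc r" h']
        tiles_in[OF \<open>X \<subseteq> V\<close> X(2)] n1 finite_V \<open>V \<noteq> {}\<close>
      by (auto simp: n_def)
    then show "\<exists>xs. distinct xs \<and> set xs \<subseteq> X \<and> tile (mset xs)"
      by (auto simp: tuples_def)
  qed (use finite_V in auto)
  then obtain W where W: "W \<subseteq> V - A - U" "real (card W) < \<kappa> * n" "packable (V - A - U - W)"
    by auto
  \<comment> \<open>Every bad vertex lies in \<open>A\<close> or, by the choice of \<open>U\<close>,
    in \<open>U\<close>.\<close>
  have "W \<subseteq> G" using W(1) U(2) by (auto simp: G_def)
  have "finite W" using W(1) finite_V by (meson finite_Diff finite_subset)
  have "packable A"
    unfolding A_def using \<C>(3) \<C>' by (intro packable_UN[OF fin\<C>] packable_set) auto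
  let ?R = "V - A - U - W"
  have "V = W \<union> (A \<union> (U \<union> ?R))" using A U W(1) by auto
  moreover have "card (W \<union> (A \<union> (U \<union> ?R))) = card W + (card A + (card U + card ?R))"
    using A(1) finite_subset[OF U(1) finite_V] \<open>finite W\<close> finite_V U(3) W(1)
    by (subst card_Un_disjoint card_Un_disjoint[of A] card_Un_disjoint[of U]; (force | simp))+
  ultimately have "Suc r dvd card W + (card A + (card U + card ?R))"
    using dvd by simp
  \<comment> \<open>The other parts are packable, so their sizes are multiples of the tile size, and
    \<open>W\<close> splits into tile-sized pieces.\<close>
  then have "Suc r dvd card W"
    using dvd_card_packable \<open>packable A\<close> U(4) W(3) by (meson dvd_add dvd_add_left_iff)
  then obtain j where j: "card W = Suc r * j" by (elim dvdE)
  have "packable (W \<union> A)"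
    unfolding A_def
  proof (rule packable_absorb[OF fin\<C> _ \<C>(3) _ \<open>W \<subseteq> G\<close> \<open>finite W\<close> j])
    show "j \<le> card (\<C> \<inter> absorbers K (mset D))" if "D \<in> tuples G (Suc r)" for D
    proof -
      have "j \<le> card W" using j by simp
      then show ?thesis using hits[OF that] W(2) by linarith
    qed
    show "W \<inter> (\<Union>A\<in>\<C>. set A) = {}" using W(1) by (auto simp: A_def)
  qed (use \<C>' in auto)
  moreover have "packable (U \<union> ?R)"
    by (rule packable_Un[OF U(4) W(3)]) auto
  ultimately have "packable ((W \<union> A) \<union> (U \<union> ?R))"
    by (rule packable_Un) (use U(3) W(1) in auto)
  also have "(W \<union> A) \<union> (U \<union> ?R) = V" using A U W(1) by auto
  finally show ?thesis .
qed

end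

section \<open>Choice of the constants\<close>

lemma eventually_large:
  fixes a b c \<kappa> \<eta> :: real
  assumes "\<kappa> > 0" "a > 0" "b > 0" "c > 0"
  shows "eventually (\<lambda>x. x \<ge> 1 \<and> A < a * x \<and> B \<le> b * x \<and> C \<le> c * x \<and> x ^ k * exp \<eta> \<le> exp (\<kappa> * x)) at_top"
proof -
  have lin: "eventually (\<lambda>x. A < a * x) at_top" if "a > 0" for A a :: real
    using eventually_gt_at_top[of "A / a"] by eventually_elim (use that in \<open>simp add: field_simps\<close>)
  have "filterlim (\<lambda>x. \<kappa> * x) at_top at_top"
    using \<open>\<kappa> > 0\<close> by (intro filterlim_tendsto_pos_mult_at_top[OF tendsto_const]) (auto simp: filterlim_ident)
  then have "((\<lambda>x. (\<kappa> * x) ^ k / exp (\<kappa> * x)) \<longlongrightarrow> 0) at_top"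
    by (rule filterlim_compose[OF tendsto_power_div_exp_0])
  then have "eventually (\<lambda>x. (\<kappa> * x) ^ k / exp (\<kappa> * x) < \<kappa> ^ k / exp \<eta>) at_top"
    by (rule order_tendstoD(2)) (use \<open>\<kappa> > 0\<close> in simp)
  then have "eventually (\<lambda>x. x ^ k * exp \<eta> \<le> exp (\<kappa> * x)) at_top"
    by eventually_elim (use \<open>\<kappa> > 0\<close> in \<open>simp add: field_simps power_mult_distrib\<close>)
  then show ?thesis
    using eventually_ge_at_top[of "1::real"] lin[OF \<open>a > 0\<close>, of A] lin[OF \<open>b > 0\<close>, of B]
      lin[OF \<open>c > 0\<close>, of C]
    by eventually_elim auto
qed

text \<open>The constants are fixed before \<open>\<epsilon>\<close>, below which the densities are never needed; this is what allows \<open>\<mu>\<close>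
  to be chosen afterwards.\<close>

definition abundant_tiles ::
  "'a set \<Rightarrow> ('a multiset \<Rightarrow> bool) \<Rightarrow> nat \<Rightarrow> nat \<Rightarrow> real \<Rightarrow> (real \<Rightarrow> real) \<Rightarrow> (real \<Rightarrow> real) \<Rightarrow> real \<Rightarrow> bool" where
  "abundant_tiles V tile r s c g h \<epsilon> \<longleftrightarrow>
    (\<forall>w\<in>V. real (card {Q \<in> tuples V r. tile (add_mset w (mset Q))}) \<ge> c * real (card V) ^ r) \<and>
    (\<forall>\<delta>\<ge>\<epsilon>. \<forall>X\<subseteq>V. real (card X) \<ge> \<delta> * real (card V) \<longrightarrow>
      real (card {xs \<in> tuples X (Suc r). tile (mset xs)}) \<ge> h \<delta> * real (card V) ^ Suc r) \<and>
    (\<forall>\<delta>\<ge>\<epsilon>. \<forall>X\<subseteq>V. \<forall>Y\<subseteq>V. real (card X) \<ge> \<delta> * real (card V) \<longrightarrow> real (card Y) \<ge> \<delta> * real (card V) \<longrightarrow>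
      (\<Sum>x\<in>X. \<Sum>y\<in>Y. real (card (tile_system.swaps V tile s {#x#} {#y#}))) \<ge> g \<delta> * real (card V) ^ (s + 2))"

theorem packable_large:
  fixes g h :: "real \<Rightarrow> real" and c :: real and r s :: nat
  assumes "c > 0" and g: "\<And>\<delta>. \<delta> > 0 \<Longrightarrow> g \<delta> > 0" and h: "\<And>\<delta>. \<delta> > 0 \<Longrightarrow> h \<delta> > 0"
  shows "\<exists>\<epsilon>>0. \<exists>n0. \<forall>(V :: 'a set) tile spans. tile_system V tile spans r \<longrightarrow> card V \<ge> n0 \<longrightarrow>
    abundant_tiles V tile r s c g h \<epsilon> \<longrightarrow> Suc r dvd card V \<longrightarrow> tile_system.packable spans V"
proof -
  \<comment> \<open>Covering the bad vertices has to stay below c * n. One quarter each is reserved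
    for the bad vertices and their tiles (\<beta>), for the absorbing set (second bound on \<theta>)
    and for the constant terms.\<close>
  define \<beta> where "\<beta> = min (1 / 2) (c / (4 * (real (Suc r))\<^sup>2))"
  define \<gamma> where "\<gamma> = g \<beta>"
  define \<delta> where "\<delta> = g (\<gamma> / 2)"
  define \<eta> where "\<eta> = h (1 / 2) * ((\<gamma> / 2)\<^sup>2 * \<delta>) ^ Suc r"
  define K where "K = Suc r + Suc r * (3 * s + 2)"
  \<comment> \<open>About \<theta> * n absorbers are selected. The first bound leaves room for that
    many disjoint ones from families of density \<eta>/2.\<close>
  define \<theta> where "\<theta> = min (\<eta> / (4 * (real K)\<^sup>2)) (c / (4 * real (Suc r) * real K))"
  \<comment> \<open>After \<theta> * n selections the potential is at most a polynomial times
    exp(-\<eta> \<theta> n / 8) = exp(-2 \<kappa> n), up to rounding. Half of the exponent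
    compensates for the polynomial, the other half is below 2^(-\<kappa> n).\<close>
  define \<kappa> where "\<kappa> = \<eta> * \<theta> / 16"
  define \<epsilon> where "\<epsilon> = min (min \<beta> (\<gamma> / 2)) (min (1 / 2) \<kappa>)"
  have \<beta>: "\<beta> > 0" "\<beta> \<le> 1 / 2" and \<beta>c: "4 * (real (Suc r))\<^sup>2 * \<beta> \<le> c"
    using \<open>c > 0\<close> by (auto simp: \<beta>_def min_def field_simps)
  have \<gamma>: "\<gamma> > 0" and \<delta>: "\<delta> > 0" using g \<beta> by (auto simp: \<gamma>_def \<delta>_def)
  have \<eta>: "\<eta> > 0" using h[of "1 / 2"] \<gamma> \<delta> by (simp add: \<eta>_def)
  have K: "real K > 0" unfolding K_def of_nat_0_less_iff by simp
  have \<theta>: "\<theta> > 0" using \<eta> K \<open>c > 0\<close> by (simp add: \<theta>_def)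
  have "\<theta> \<le> \<eta> / (4 * (real K)\<^sup>2)" "\<theta> \<le> c / (4 * real (Suc r) * real K)" by (auto simp: \<theta>_def)
  then have \<theta>\<eta>: "4 * (real K)\<^sup>2 * \<theta> \<le> \<eta>" and \<theta>c: "4 * real (Suc r) * real K * \<theta> \<le> c"
    using K by (simp_all add: pos_le_divide_eq ac_simps del: of_nat_Suc)
  have \<kappa>: "\<kappa> > 0" using \<eta> \<theta> by (simp add: \<kappa>_def)
  have \<epsilon>: "\<epsilon> > 0" "\<epsilon> \<le> \<beta>" "\<epsilon> \<le> \<gamma> / 2" "\<epsilon> \<le> 1 / 2" "\<epsilon> \<le> \<kappa>"
    using \<beta> \<gamma> \<kappa> by (auto simp: \<epsilon>_def)
  obtain x0 where large: "\<And>x. x \<ge> x0 \<Longrightarrow> x \<ge> 1 \<and> (real (Suc r))\<^sup>2 < h \<kappa> * x \<and> 2 * (real K)\<^sup>2 \<le> \<eta> * x \<and>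
      real r + (real r)\<^sup>2 \<le> c / 4 * x \<and> x ^ Suc r * exp (\<eta> / 8) \<le> exp (\<kappa> * x)"
    using eventually_large[OF \<kappa> h[OF \<kappa>] \<eta>, of "c / 4" "(real (Suc r))\<^sup>2" "2 * (real K)\<^sup>2" "real r + (real r)\<^sup>2"
        "Suc r" "\<eta> / 8"] \<open>c > 0\<close>
    unfolding eventually_at_top_linorder by auto
  show ?thesis
  proof (intro exI[of _ \<epsilon>] exI[of _ "nat \<lceil>x0\<rceil>"] conjI allI impI \<epsilon>(1))
    fix V :: "'a set" and tile spans
    assume ts: "tile_system V tile spans r" and "nat \<lceil>x0\<rceil> \<le> card V"
      and ab: "abundant_tiles V tile r s c g h \<epsilon>" and dvd: "Suc r dvd card V"
    interpret tile_system V tile spans r by (rule ts)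
    let ?n = "real (card V)"
    have "?n \<ge> x0" using \<open>nat \<lceil>x0\<rceil> \<le> card V\<close> by linarith
    note n = large[OF this]
    define m where "m = nat \<lfloor>\<theta> * ?n\<rfloor>"
    have m: "real m \<le> \<theta> * ?n" "real m \<ge> \<theta> * ?n - 1"
      using \<theta> by (auto simp: m_def) 
    show "packable V"
    proof (rule packable_V[where \<beta> = \<beta> and \<gamma> = \<gamma> and \<delta> = \<delta> and c = c and h = "h (1 / 2)"
          and h' = "h \<kappa>" and \<kappa> = \<kappa> and s = s and m = m, folded \<eta>_def K_def])
      show "V \<noteq> {}" using n by auto
      show "\<gamma> * ?n ^ (s + 2) \<le> (\<Sum>x\<in>X. \<Sum>y\<in>V. real (card (swaps s {#x#} {#y#})))"
        if "X \<subseteq> V" "\<beta> * ?n \<le> real (card X)" for X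
      proof -
        have "\<beta> * ?n \<le> 1 * ?n" using \<beta>(2) by (intro mult_right_mono) auto
        then have "\<beta> * ?n \<le> ?n" by simp
        then show ?thesis using ab \<epsilon>(2) that unfolding \<gamma>_def abundant_tiles_def by blast
      qed
      show "\<delta> * ?n ^ (s + 2) \<le> (\<Sum>x\<in>X. \<Sum>y\<in>Y. real (card (swaps s {#x#} {#y#})))"
        if "X \<subseteq> V" "Y \<subseteq> V" "\<gamma> / 2 * ?n \<le> real (card X)" "\<gamma> / 2 * ?n \<le> real (card Y)" for X Y
        using ab \<epsilon>(3) that unfolding \<delta>_def abundant_tiles_def by blast
      show "h (1 / 2) * ?n ^ Suc r \<le> real (card {xs \<in> tuples X (Suc r). tile (mset xs)})"
        if "X \<subseteq> V" "1 / 2 * ?n \<le> real (card X)" for X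
        using ab \<epsilon>(4) that unfolding abundant_tiles_def by blast
      show "h \<kappa> * ?n ^ Suc r \<le> real (card {xs \<in> tuples X (Suc r). tile (mset xs)})"
        if "X \<subseteq> V" "\<kappa> * ?n \<le> real (card X)" for X
        using ab \<epsilon>(5) that unfolding abundant_tiles_def by blast
      show "4 * (real K)\<^sup>2 * real m \<le> \<eta> * ?n"
      proof -
        have "4 * (real K)\<^sup>2 * real m \<le> 4 * (real K)\<^sup>2 * (\<theta> * ?n)"
          using m(1) by (intro mult_left_mono) auto
        also have "\<dots> = (4 * (real K)\<^sup>2 * \<theta>) * ?n" by simp
        also have "\<dots> \<le> \<eta> * ?n" using \<theta>\<eta> by (intro mult_right_mono) auto
        finally show ?thesis .
      qed
      show "real r * (real K * real m + real (Suc r) * (\<beta> * ?n) + 1) + (real r)\<^sup>2 < c * ?n"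
      proof -
        have "4 * (real r * (real K * real m)) \<le> 4 * (real (Suc r) * (real K * (\<theta> * ?n)))"
          using m(1) by (intro mult_left_mono mult_mono) auto
        also have "\<dots> = (4 * real (Suc r) * real K * \<theta>) * ?n" by simp
        also have "\<dots> \<le> c * ?n" using \<theta>c by (intro mult_right_mono) auto
        finally have 1: "4 * (real r * (real K * real m)) \<le> c * ?n" .
        have "4 * (real r * (real (Suc r) * (\<beta> * ?n))) \<le> 4 * (real (Suc r) * (real (Suc r) * (\<beta> * ?n)))"
          using \<beta> by (intro mult_left_mono mult_right_mono) auto
        also have "\<dots> = (4 * (real (Suc r))\<^sup>2 * \<beta>) * ?n" by (simp add: power2_eq_square)
        also have "\<dots> \<le> c * ?n" using \<beta>c by (intro mult_right_mono) auto
        finally have 2: "4 * (real r * (real (Suc r) * (\<beta> * ?n))) \<le> c * ?n" .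
        have 3: "4 * (real r + (real r)\<^sup>2) \<le> c * ?n" using n by simp
        have 4: "c * ?n > 0" using n \<open>c > 0\<close> by simp
        show ?thesis
          using 1 2 3 4 by (simp only: distrib_left mult_1_right)
      qed
      show "?n ^ Suc r * exp (- (\<eta> / 8) * real m) \<le> (1 / 2) powr (\<kappa> * ?n)"
      proof -
        \<comment> \<open>Rounding \<open>m\<close> down costs less than one selection, that is, at
          most a factor exp(\<eta>/8).\<close>
        have "\<eta> / 8 * (\<theta> * ?n - 1) \<le> \<eta> / 8 * real m" using m(2) \<eta> by (intro mult_left_mono) auto
        then have "- (\<eta> / 8) * real m \<le> \<eta> / 8 - 2 * (\<kappa> * ?n)" by (simp add: \<kappa>_def algebra_simps)
        then have "?n ^ Suc r * exp (- (\<eta> / 8) * real m) \<le> ?n ^ Suc r * exp (\<eta> / 8 - 2 * (\<kappa> * ?n))"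
          by (intro mult_left_mono) auto
        also have "\<dots> = (?n ^ Suc r * exp (\<eta> / 8)) * exp (- (2 * (\<kappa> * ?n)))"
          by (simp only: diff_conv_add_uminus exp_add mult.assoc)
        also have "\<dots> \<le> exp (\<kappa> * ?n) * exp (- (2 * (\<kappa> * ?n)))"
          using n by (intro mult_right_mono) auto
        also have "\<dots> = exp (- (\<kappa> * ?n))" by (simp flip: exp_add)
        also have "\<dots> \<le> exp (- (\<kappa> * ?n) * ln 2)"
          using \<kappa> n ln_2_less_1 mult_left_mono[of "ln 2" 1 "\<kappa> * ?n"] by simp
        also have "\<dots> = (1 / 2) powr (\<kappa> * ?n)" by (simp add: powr_def ln_div)
        finally show ?thesis .
      qed
      show "c * ?n ^ r \<le> real (card {Q \<in> tuples V r. tile (add_mset w (mset Q))})" if "w \<in> V" for w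
        using ab that unfolding abundant_tiles_def by blast
    qed (use n \<beta> \<gamma> \<delta> h[of "1 / 2"] dvd in auto)
  qed
qed

section \<open>Counting homomorphic copies of patterns\<close>

text \<open>A sum of indicators, so that Fubini and Cauchy-Schwarz apply directly. The maps need not
  be injective.\<close>

definition hom_count :: "'i set \<Rightarrow> 'a set \<Rightarrow> (('i \<Rightarrow> 'a) \<Rightarrow> bool) \<Rightarrow> real" where
  "hom_count I V P = (\<Sum>\<phi>\<in>I \<rightarrow>\<^sub>E V. of_bool (P \<phi>))"

text \<open>Ensures that a condition is unaffected by the indices added later, where members of
  \<open>I \<rightarrow>\<^sub>E V\<close> are \<open>undefined\<close>.\<close>

definition local_on :: "'i set \<Rightarrow> (('i \<Rightarrow> 'a) \<Rightarrow> bool) \<Rightarrow> bool" where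
  "local_on I P \<longleftrightarrow> (\<forall>\<phi> \<psi>. (\<forall>i\<in>I. \<phi> i = \<psi> i) \<longrightarrow> P \<phi> = P \<psi>)"

lemma local_onD: "local_on I P \<Longrightarrow> (\<And>i. i \<in> I \<Longrightarrow> \<phi> i = \<psi> i) \<Longrightarrow> P \<phi> = P \<psi>"
  unfolding local_on_def by blast

lemma sum_PiE_insert:
  fixes F :: "('i \<Rightarrow> 'a) \<Rightarrow> real"
  assumes "i \<notin> I"
  shows "(\<Sum>\<phi>\<in>insert i I \<rightarrow>\<^sub>E V. F \<phi>) = (\<Sum>\<phi>\<in>I \<rightarrow>\<^sub>E V. \<Sum>x\<in>V. F (\<phi>(i := x)))"
proof -
  have "(\<Sum>\<phi>\<in>insert i I \<rightarrow>\<^sub>E V. F \<phi>) = (\<Sum>(x, \<phi>)\<in>V \<times> (I \<rightarrow>\<^sub>E V). F (\<phi>(i := x)))"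
    using assms inj_combinator[OF assms, of "\<lambda>_. V"]
    by (subst PiE_insert_eq, subst sum.reindex) (auto simp: case_prod_unfold)
  then show ?thesis
    by (simp add: sum.cartesian_product[symmetric] sum.swap[of _ V])
qed

lemma hom_count_mono:
  assumes "finite I" "finite V" "\<And>\<phi>. \<phi> \<in> I \<rightarrow>\<^sub>E V \<Longrightarrow> P \<phi> \<Longrightarrow> Q \<phi>"
  shows "hom_count I V P \<le> hom_count I V Q"
  unfolding hom_count_def using assms(3) by (intro sum_mono) auto

lemma hom_count_le_card:
  assumes I: "finite I" "finite V" "I = set is" and S: "finite S"
    and map: "\<And>\<phi>. \<phi> \<in> I \<rightarrow>\<^sub>E V \<Longrightarrow> P \<phi> \<Longrightarrow> map \<phi> is \<in> S"
  shows "hom_count I V P \<le> real (card S)"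
proof -
  have fin: "finite (I \<rightarrow>\<^sub>E V)" using I by (intro finite_PiE) auto
  have "hom_count I V P = real (card {\<phi> \<in> I \<rightarrow>\<^sub>E V. P \<phi>})"
    unfolding hom_count_def using fin by (simp add: of_bool_def sum.If_cases Int_def)
  also have "card {\<phi> \<in> I \<rightarrow>\<^sub>E V. P \<phi>} \<le> card S"
  proof (rule card_inj_on_le[OF _ _ S])
    show "inj_on (\<lambda>\<phi>. map \<phi> is) {\<phi> \<in> I \<rightarrow>\<^sub>E V. P \<phi>}"
      unfolding inj_on_def using I(3) by (auto intro: PiE_ext)
  qed (use map in auto)
  finally show ?thesis by simp
qed

lemma hom_count_box:
  assumes "finite I" "\<And>i. i \<in> I \<Longrightarrow> D i \<subseteq> V" "finite V"
  shows "hom_count I V (\<lambda>\<phi>. \<forall>i\<in>I. \<phi> i \<in> D i) = (\<Prod>i\<in>I. real (card (D i)))"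
proof -
  have fin: "finite (I \<rightarrow>\<^sub>E V)" using assms by (intro finite_PiE) auto
  have "hom_count I V (\<lambda>\<phi>. \<forall>i\<in>I. \<phi> i \<in> D i) = real (card {\<phi> \<in> I \<rightarrow>\<^sub>E V. \<forall>i\<in>I. \<phi> i \<in> D i})"
    unfolding hom_count_def using fin by (simp add: of_bool_def sum.If_cases Int_def)
  also have "{\<phi> \<in> I \<rightarrow>\<^sub>E V. \<forall>i\<in>I. \<phi> i \<in> D i} = Pi\<^sub>E I D"
    using assms(2) by (fastforce simp: PiE_iff)
  also have "real (card (Pi\<^sub>E I D)) = (\<Prod>i\<in>I. real (card (D i)))"
    using assms(1) by (simp add: card_PiE)
  finally show ?thesis .
qed

text \<open>With the other coordinates fixed to \<psi>, doubling \<open>i\<close> squares the number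
  \<open>a \<psi>\<close> of choices for it. Cauchy-Schwarz bounds the sum of these squares from
  below.\<close>

lemma hom_count_double:
  fixes d :: real
  assumes fin: "finite I" "finite V" and i: "i \<in> I" "i' \<notin> I" and loc: "local_on I P"
    and d: "d \<ge> 0" "hom_count I V P \<ge> d * real (card V) ^ card I"
  shows "hom_count (insert i' I) V (\<lambda>\<phi>. P \<phi> \<and> P (\<phi>(i := \<phi> i'))) \<ge> d\<^sup>2 * real (card V) ^ Suc (card I)"
proof (cases "card V = 0")
  case True
  then show ?thesis by (simp add: hom_count_def sum_nonneg)
next
  case False
  let ?n = "real (card V)" and ?J = "I - {i}"
  have I: "I = insert i ?J" "i \<notin> ?J" using i by auto
  have cI: "card I = Suc (card ?J)" using card.remove[OF fin(1) i(1)] .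
  define a where "a \<psi> = (\<Sum>x\<in>V. of_bool (P (\<psi>(i := x))) :: real)" for \<psi>
  have sum_a: "hom_count I V P = (\<Sum>\<psi>\<in>?J \<rightarrow>\<^sub>E V. a \<psi>)"
    unfolding hom_count_def a_def by (subst I(1), subst sum_PiE_insert[OF I(2)]) simp
  have ne: "i \<noteq> i'" using i by auto
  have P1: "P (\<phi>(i' := y)) = P \<phi>" for \<phi> y
    by (rule local_onD[OF loc]) (use i in auto)
  have P2: "P ((\<phi>(i' := y))(i := y)) = P (\<phi>(i := y))" for \<phi> y
    by (rule local_onD[OF loc]) (use i in auto)
  have "hom_count (insert i' I) V (\<lambda>\<phi>. P \<phi> \<and> P (\<phi>(i := \<phi> i')))
      = (\<Sum>\<phi>\<in>I \<rightarrow>\<^sub>E V. \<Sum>y\<in>V. of_bool (P \<phi> \<and> P (\<phi>(i := y))))"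
    unfolding hom_count_def by (subst sum_PiE_insert[OF i(2)]) (simp add: P1 P2)
  also have "\<dots> = (\<Sum>\<psi>\<in>?J \<rightarrow>\<^sub>E V. \<Sum>x\<in>V. \<Sum>y\<in>V. of_bool (P (\<psi>(i := x)) \<and> P (\<psi>(i := y))))"
    by (subst I(1), subst sum_PiE_insert[OF I(2)]) simp
  also have "\<dots> = (\<Sum>\<psi>\<in>?J \<rightarrow>\<^sub>E V. (a \<psi>)\<^sup>2)"
    unfolding a_def power2_eq_square sum_product by (simp add: of_bool_conj)
  finally have sum_sq: "hom_count (insert i' I) V (\<lambda>\<phi>. P \<phi> \<and> P (\<phi>(i := \<phi> i')))
      = (\<Sum>\<psi>\<in>?J \<rightarrow>\<^sub>E V. (a \<psi>)\<^sup>2)" .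
  have "(d * ?n ^ card I)\<^sup>2 \<le> (\<Sum>\<psi>\<in>?J \<rightarrow>\<^sub>E V. a \<psi>)\<^sup>2"
    using d sum_a by (intro power_mono) auto
  also have "\<dots> \<le> real (card (?J \<rightarrow>\<^sub>E V)) * (\<Sum>\<psi>\<in>?J \<rightarrow>\<^sub>E V. (a \<psi>)\<^sup>2)"
    using Cauchy_Schwarz_ineq_sum[of "\<lambda>_. 1" a "?J \<rightarrow>\<^sub>E V"] by simp
  also have "card (?J \<rightarrow>\<^sub>E V) = card V ^ card ?J" using fin by (simp add: card_PiE)
  finally have "(d\<^sup>2 * ?n ^ Suc (card I)) * ?n ^ card ?J \<le> (\<Sum>\<psi>\<in>?J \<rightarrow>\<^sub>E V. (a \<psi>)\<^sup>2) * ?n ^ card ?J"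
    by (simp add: cI power2_eq_square power_mult_distrib ac_simps)
  moreover have "?n ^ card ?J > 0" using False by simp
  ultimately show ?thesis unfolding sum_sq by (simp only: mult_le_cancel_right_pos)
qed

text \<open>The twin of the vertex \<open>a\<close> is \<open>a + q\<close>; \<open>C\<close> is the set of vertices replaced by their twins.\<close>

definition blow_up :: "nat \<Rightarrow> nat set \<Rightarrow> ((nat \<Rightarrow> 'a) \<Rightarrow> bool) \<Rightarrow> (nat \<Rightarrow> 'a) \<Rightarrow> bool" where
  "blow_up q J P \<phi> \<longleftrightarrow> (\<forall>C\<subseteq>J. P (\<lambda>a. \<phi> (if a \<in> C then a + q else a)))"

lemma local_on_blow_up:
  assumes "local_on I P"
  shows "local_on (I \<union> (\<lambda>a. a + q) ` J) (blow_up q J P)"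
  unfolding local_on_def blow_up_def
  by (intro allI impI arg_cong[where f = All] ext imp_cong refl local_onD[OF assms]) auto

text \<open>The members of \<open>J\<close> are doubled one at a time, and each doubling squares the
  density; this is the exponent 2^|J|. The bound \<open>q\<close> on the indices separates twins
  from original vertices.\<close>

lemma hom_count_blow_up:
  fixes d :: real
  assumes "finite I" "finite V" "finite J" "J \<subseteq> I" "I \<subseteq> {..<q}" "local_on I P"
    and "d \<ge> 0" "hom_count I V P \<ge> d * real (card V) ^ card I"
  shows "hom_count (I \<union> (\<lambda>a. a + q) ` J) V (blow_up q J P)
    \<ge> d ^ (2 ^ card J) * real (card V) ^ (card I + card J)"
  using assms(3,4)
proof (induction J)
  case empty
  then show ?case using assms(8) by (simp add: blow_up_def[abs_def])
next
  case (insert j J)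
  let ?I = "I \<union> (\<lambda>a. a + q) ` J" and ?P = "blow_up q J P"
  have j: "j \<in> I" "j < q" using insert.prems assms(5) by auto
  have disj: "I \<inter> (\<lambda>a. a + q) ` J = {}" using assms(5) by auto
  have card: "card ?I = card I + card J"
    using assms(1) insert.hyps disj by (simp add: card_Un_disjoint card_image)
  have new: "j + q \<notin> ?I" using assms(5) insert.hyps by auto
  have "(d ^ (2 ^ card J))\<^sup>2 * real (card V) ^ Suc (card ?I)
      \<le> hom_count (insert (j + q) ?I) V (\<lambda>\<phi>. ?P \<phi> \<and> ?P (\<phi>(j := \<phi> (j + q))))"
    using insert assms j(1) new local_on_blow_up[OF assms(6)]
    by (intro hom_count_double) (auto simp: card)
  also have "\<dots> \<le> hom_count (insert (j + q) ?I) V (blow_up q (insert j J) P)"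
  proof (rule hom_count_mono)
    fix \<phi> assume \<phi>: "?P \<phi> \<and> ?P (\<phi>(j := \<phi> (j + q)))"
    show "blow_up q (insert j J) P \<phi>"
      unfolding blow_up_def
    proof (intro allI impI)
      fix C assume C: "C \<subseteq> insert j J"
      show "P (\<lambda>a. \<phi> (if a \<in> C then a + q else a))"
      proof (cases "j \<in> C")
        case False
        then have "C \<subseteq> J" using C by auto
        then show ?thesis using \<phi> by (auto simp: blow_up_def)
      next
        case True
        \<comment> \<open>The map \<phi>(j := \<phi> (j + q)) already uses the twin of
          \<open>j\<close>, so the induction hypothesis is applied to it with
          \<open>C - {j}\<close>.\<close>
        have "C - {j} \<subseteq> J" using C by auto
        then have "P (\<lambda>a. (\<phi>(j := \<phi> (j + q))) (if a \<in> C - {j} then a + q else a))"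
          using \<phi> unfolding blow_up_def by blast
        also have "(\<lambda>a. (\<phi>(j := \<phi> (j + q))) (if a \<in> C - {j} then a + q else a))
            = (\<lambda>a. \<phi> (if a \<in> C then a + q else a))"
        proof
          fix a
          show "(\<phi>(j := \<phi> (j + q))) (if a \<in> C - {j} then a + q else a) = \<phi> (if a \<in> C then a + q else a)"
            using True j(2) by (cases "a = j") auto
        qed
        finally show ?thesis .
      qed
    qed
  qed (use assms insert.hyps in auto)
  also have "insert (j + q) ?I = I \<union> (\<lambda>a. a + q) ` insert j J" by auto
  finally show ?case
    using insert.hyps by (simp add: card power_mult[symmetric] mult.commute)
qed

section \<open>Linear patterns and their counting lemma\<close>

definition pattern_edge :: "'a set set \<Rightarrow> ('i \<Rightarrow> 'a) \<Rightarrow> 'i \<times> 'i \<times> 'i \<Rightarrow> bool" where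
  "pattern_edge E \<phi> = (\<lambda>(a, b, c). {\<phi> a, \<phi> b, \<phi> c} \<in> E)"

text \<open>The usual linearity: two edges share at most one vertex. Each edge is compared only with
  those after it in the list, which suits an induction that adds the head last.\<close>

fun linear_pattern :: "'i set \<Rightarrow> ('i \<times> 'i \<times> 'i) list \<Rightarrow> bool" where
  "linear_pattern I [] = True"
| "linear_pattern I ((i, j, k) # es) = (i \<in> I \<and> j \<in> I \<and> k \<in> I \<and> i \<noteq> j \<and> i \<noteq> k \<and> j \<noteq> k \<and>
    (\<forall>(a, b, c)\<in>set es. (i \<notin> {a, b, c} \<and> j \<notin> {a, b, c}) \<or> (i \<notin> {a, b, c} \<and> k \<notin> {a, b, c}) \<or>
      (j \<notin> {a, b, c} \<and> k \<notin> {a, b, c})) \<and> linear_pattern I es)"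

locale weakly_quasirandom =
  fixes V :: "'a set" and E :: "'a set set" and p \<mu> :: real
  assumes finite_V: "finite V"
    and edge_count_ge: "X \<subseteq> V \<Longrightarrow> Y \<subseteq> V \<Longrightarrow> Z \<subseteq> V \<Longrightarrow>
      real (edge_count E X Y Z) \<ge> p * real (card X) * real (card Y) * real (card Z) - \<mu> * real (card V) ^ 3"
begin

lemma edge_count_eq_sum:
  assumes "X \<subseteq> V" "Y \<subseteq> V" "Z \<subseteq> V"
  shows "real (edge_count E X Y Z) = (\<Sum>x\<in>X. \<Sum>y\<in>Y. \<Sum>z\<in>Z. of_bool ({x, y, z} \<in> E))"
proof -
  have fin: "finite X" "finite Y" "finite Z" using assms finite_V by (auto intro: finite_subset)
  have "{(x1, x2, x3). x1 \<in> X \<and> x2 \<in> Y \<and> x3 \<in> Z \<and> {x1, x2, x3} \<in> E}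
      = {t \<in> X \<times> Y \<times> Z. case t of (x, y, z) \<Rightarrow> {x, y, z} \<in> E}"
    by auto
  then have "real (edge_count E X Y Z)
      = (\<Sum>t\<in>X \<times> Y \<times> Z. of_bool (case t of (x, y, z) \<Rightarrow> {x, y, z} \<in> E))"
    unfolding edge_count_def using fin by (simp add: of_bool_def sum.If_cases Int_def)
  also have "\<dots> = (\<Sum>x\<in>X. \<Sum>y\<in>Y. \<Sum>z\<in>Z. of_bool ({x, y, z} \<in> E))"
    by (simp add: sum.cartesian_product case_prod_unfold)
  finally show ?thesis .
qed

text \<open>With all vertices but \<open>i\<close>, \<open>j\<close>, \<open>k\<close> fixed, the admissible choices for these three form a box \<open>X \<times> Y \<times> Z\<close>.\<close>

lemma hom_count_add_edge:
  assumes "finite I" and ijk: "i \<in> I" "j \<in> I" "k \<in> I" "i \<noteq> j" "i \<noteq> k" "j \<noteq> k"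
    and P: "\<And>\<phi> x y z. P (\<phi>(i := x, j := y, k := z)) \<longleftrightarrow> A \<phi> x \<and> B \<phi> y \<and> C \<phi> z"
  shows "hom_count I V (\<lambda>\<phi>. P \<phi> \<and> pattern_edge E \<phi> (i, j, k))
    \<ge> p * hom_count I V P - \<mu> * real (card V) ^ card I"
proof -
  let ?n = "real (card V)"
  define R where "R = I - {i, j, k}"
  have I: "I = insert k (insert j (insert i R))" and ni: "i \<notin> R" "j \<notin> insert i R" "k \<notin> insert j (insert i R)"
    using ijk by (auto simp: R_def)
  have "finite R" using \<open>finite I\<close> by (simp add: R_def)
  then have cI: "card I = card R + 3" using ni unfolding I by simp
  have split: "hom_count I V Q = (\<Sum>\<phi>\<in>R \<rightarrow>\<^sub>E V. \<Sum>x\<in>V. \<Sum>y\<in>V. \<Sum>z\<in>V. of_bool (Q (\<phi>(i := x, j := y, k := z))))"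
    for Q
    unfolding hom_count_def I sum_PiE_insert[OF ni(3)] sum_PiE_insert[OF ni(2)] sum_PiE_insert[OF ni(1)] ..
  let ?X = "\<lambda>\<phi>. {x \<in> V. A \<phi> x}" and ?Y = "\<lambda>\<phi>. {y \<in> V. B \<phi> y}" and ?Z = "\<lambda>\<phi>. {z \<in> V. C \<phi> z}"
  have cnt: "(\<Sum>x\<in>V. of_bool (Q x)) = real (card {x \<in> V. Q x})" for Q
    using finite_V by (simp add: of_bool_def sum.If_cases Int_def)
  have restr: "(\<Sum>x\<in>V. of_bool (Q x) * F x) = (\<Sum>x\<in>{x \<in> V. Q x}. F x)" for Q and F :: "'a \<Rightarrow> real"
    using finite_V by (intro sum.mono_neutral_cong_right) auto
  have "p * hom_count I V P - \<mu> * ?n ^ card I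
      = (\<Sum>\<phi>\<in>R \<rightarrow>\<^sub>E V. p * real (card (?X \<phi>)) * real (card (?Y \<phi>)) * real (card (?Z \<phi>)) - \<mu> * ?n ^ 3)"
  proof -
    have "(\<Sum>x\<in>V. \<Sum>y\<in>V. \<Sum>z\<in>V. of_bool (P (\<phi>(i := x, j := y, k := z))))
        = real (card (?X \<phi>)) * real (card (?Y \<phi>)) * real (card (?Z \<phi>))" for \<phi>
      unfolding P of_bool_conj cnt[symmetric]
      by (simp only: sum_distrib_left[symmetric] sum_distrib_right[symmetric] mult.assoc)
    moreover have "card (R \<rightarrow>\<^sub>E V) = card V ^ card R" using \<open>finite R\<close> by (simp add: card_PiE)
    ultimately show ?thesis
      unfolding split by (simp add: sum_subtractf sum_distrib_left cI power_add mult.assoc)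
  qed
  also have "\<dots> \<le> (\<Sum>\<phi>\<in>R \<rightarrow>\<^sub>E V. real (edge_count E (?X \<phi>) (?Y \<phi>) (?Z \<phi>)))"
    by (intro sum_mono edge_count_ge) auto
  also have "\<dots> = hom_count I V (\<lambda>\<phi>. P \<phi> \<and> pattern_edge E \<phi> (i, j, k))"
  proof -
    have "real (edge_count E (?X \<phi>) (?Y \<phi>) (?Z \<phi>))
        = (\<Sum>x\<in>V. \<Sum>y\<in>V. \<Sum>z\<in>V. of_bool (A \<phi> x) * (of_bool (B \<phi> y) * (of_bool (C \<phi> z) * of_bool ({x, y, z} \<in> E))))" for \<phi>
      by (subst edge_count_eq_sum) (auto simp: restr simp flip: sum_distrib_left)
    then show ?thesis
      unfolding split P using ijk by (simp add: pattern_edge_def of_bool_conj ac_simps)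
  qed
  finally show ?thesis .
qed

text \<open>The counting lemma for linear hypergraphs. A new edge shares at most one vertex with
  each of the others, so their conditions split into one condition on each of its three vertices.
  Adding it multiplies the density by \<open>p\<close> and loses at most \<mu>; earlier losses do
  not grow because p \<le> 1.\<close>

lemma hom_count_linear_pattern:
  fixes I :: "'i set" and D :: "'i \<Rightarrow> 'a set"
  assumes "finite I" "linear_pattern I es" "0 \<le> p" "p \<le> 1" "0 \<le> \<mu>"
    and base: "hom_count I V (\<lambda>\<phi>. \<forall>i\<in>I. \<phi> i \<in> D i) \<ge> d * real (card V) ^ card I"
  shows "hom_count I V (\<lambda>\<phi>. (\<forall>i\<in>I. \<phi> i \<in> D i) \<and> (\<forall>e\<in>set es. pattern_edge E \<phi> e))
    \<ge> (p ^ length es * d - real (length es) * \<mu>) * real (card V) ^ card I"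
  using assms(2)
proof (induction es)
  case Nil
  then show ?case using base by simp
next
  case (Cons e es)
  let ?n = "real (card V)"
  obtain i j k where e: "e = (i, j, k)" by (cases e)
  let ?P = "\<lambda>\<phi>. (\<forall>i\<in>I. \<phi> i \<in> D i) \<and> (\<forall>e\<in>set es. pattern_edge E \<phi> e)"
  let ?vs = "\<lambda>(a, b, c). {a, b, c}"
  have cong: "pattern_edge E \<phi> e' = pattern_edge E \<psi> e'" if "\<And>a. a \<in> ?vs e' \<Longrightarrow> \<phi> a = \<psi> a" for \<phi> \<psi> e'
    using that by (cases e') (auto simp: pattern_edge_def)
  have lin: "i \<in> I" "j \<in> I" "k \<in> I" "i \<noteq> j" "i \<noteq> k" "j \<noteq> k"
    and disj: "\<And>e'. e' \<in> set es \<Longrightarrow> (i \<notin> ?vs e' \<and> j \<notin> ?vs e') \<or> (i \<notin> ?vs e' \<and> k \<notin> ?vs e') \<or> (j \<notin> ?vs e' \<and> k \<notin> ?vs e')"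
    and "linear_pattern I es"
    using Cons.prems unfolding e by auto
  \<comment> \<open>Vertex \<open>l\<close> is responsible for the edges avoiding the other two.
    Edges avoiding all three are repeated for each vertex, which does no harm.\<close>
  let ?A = "\<lambda>l \<phi> x. x \<in> D l \<and> (\<forall>e'\<in>set es. ({i, j, k} - {l}) \<inter> ?vs e' = {} \<longrightarrow> pattern_edge E (\<phi>(l := x)) e')"
  have "p * hom_count I V ?P - \<mu> * ?n ^ card I
      \<le> hom_count I V (\<lambda>\<phi>. ?P \<phi> \<and> pattern_edge E \<phi> (i, j, k))"
  proof (rule hom_count_add_edge[OF \<open>finite I\<close> lin])
    fix \<phi> :: "'i \<Rightarrow> 'a" and x y z
    let ?\<psi> = "\<phi>(i := x, j := y, k := z)"
    have "(\<forall>a\<in>I. ?\<psi> a \<in> D a) \<longleftrightarrow> (\<forall>a\<in>I - {i, j, k}. \<phi> a \<in> D a) \<and> x \<in> D i \<and> y \<in> D j \<and> z \<in> D k"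
      using lin by auto
    moreover have "(\<forall>e'\<in>set es. pattern_edge E ?\<psi> e') \<longleftrightarrow>
        (\<forall>e'\<in>set es. (({i, j, k} - {i}) \<inter> ?vs e' = {} \<longrightarrow> pattern_edge E (\<phi>(i := x)) e') \<and>
          (({i, j, k} - {j}) \<inter> ?vs e' = {} \<longrightarrow> pattern_edge E (\<phi>(j := y)) e') \<and>
          (({i, j, k} - {k}) \<inter> ?vs e' = {} \<longrightarrow> pattern_edge E (\<phi>(k := z)) e'))"
    proof (rule ball_cong[OF refl])
      fix e' assume e': "e' \<in> set es"
      have 1: "pattern_edge E ?\<psi> e' = pattern_edge E (\<phi>(i := x)) e'" if "({i, j, k} - {i}) \<inter> ?vs e' = {}"
        by (rule cong) (use that lin in auto)
      have 2: "pattern_edge E ?\<psi> e' = pattern_edge E (\<phi>(j := y)) e'" if "({i, j, k} - {j}) \<inter> ?vs e' = {}"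
        by (rule cong) (use that lin in auto)
      have 3: "pattern_edge E ?\<psi> e' = pattern_edge E (\<phi>(k := z)) e'" if "({i, j, k} - {k}) \<inter> ?vs e' = {}"
        by (rule cong) (use that lin in auto)
      have "({i, j, k} - {i}) \<inter> ?vs e' = {} \<or> ({i, j, k} - {j}) \<inter> ?vs e' = {} \<or> ({i, j, k} - {k}) \<inter> ?vs e' = {}"
        using disj[OF e'] by blast
      with 1 2 3 show "pattern_edge E ?\<psi> e' \<longleftrightarrow>
          (({i, j, k} - {i}) \<inter> ?vs e' = {} \<longrightarrow> pattern_edge E (\<phi>(i := x)) e') \<and>
          (({i, j, k} - {j}) \<inter> ?vs e' = {} \<longrightarrow> pattern_edge E (\<phi>(j := y)) e') \<and>
          (({i, j, k} - {k}) \<inter> ?vs e' = {} \<longrightarrow> pattern_edge E (\<phi>(k := z)) e')"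
        by argo
    qed
    ultimately show "?P ?\<psi> \<longleftrightarrow> ((\<forall>a\<in>I - {i, j, k}. \<phi> a \<in> D a) \<and> ?A i \<phi> x) \<and> ?A j \<phi> y \<and> ?A k \<phi> z"
      unfolding ball_conj_distrib by argo
  qed
  also have "\<dots> = hom_count I V (\<lambda>\<phi>. (\<forall>i\<in>I. \<phi> i \<in> D i) \<and> (\<forall>e\<in>set (e # es). pattern_edge E \<phi> e))"
    unfolding e by (intro arg_cong[where f = "hom_count I V"]) auto
  finally have ge: "p * hom_count I V ?P - \<mu> * ?n ^ card I \<le> \<dots>" .
  have "p * ((p ^ length es * d - real (length es) * \<mu>) * ?n ^ card I) \<le> p * hom_count I V ?P"
    using Cons.IH[OF \<open>linear_pattern I es\<close>] \<open>0 \<le> p\<close> by (rule mult_left_mono)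
  moreover have "p * (real (length es) * \<mu>) * ?n ^ card I \<le> 1 * (real (length es) * \<mu>) * ?n ^ card I"
    using assms by (intro mult_right_mono) auto
  ultimately show ?case using ge by (simp add: algebra_simps)
qed

end

lemma linear_pattern_edge:
  "linear_pattern I es \<Longrightarrow> (a, b, c) \<in> set es \<Longrightarrow>
    a \<in> I \<and> b \<in> I \<and> c \<in> I \<and> a \<noteq> b \<and> a \<noteq> c \<and> b \<noteq> c"
  by (induction I es rule: linear_pattern.induct) auto

lemma hom_count_insert_free:
  assumes "finite V" "i \<notin> I" "local_on I P"
  shows "hom_count (insert i I) V P = real (card V) * hom_count I V P"
proof -
  have "P (\<phi>(i := x)) = P \<phi>" for \<phi> x
    by (rule local_onD[OF assms(3)]) (use assms(2) in auto)
  then show ?thesis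
    unfolding hom_count_def sum_PiE_insert[OF assms(2)] by (simp add: sum_distrib_left)
qed

definition pattern_hom :: "'a set set \<Rightarrow> 'i set \<Rightarrow> ('i \<Rightarrow> 'a set) \<Rightarrow> ('i \<times> 'i \<times> 'i) list \<Rightarrow> ('i \<Rightarrow> 'a) \<Rightarrow> bool" where
  "pattern_hom E I D es \<phi> \<longleftrightarrow> (\<forall>i\<in>I. \<phi> i \<in> D i) \<and> (\<forall>e\<in>set es. pattern_edge E \<phi> e)"

lemma local_on_pattern_hom:
  assumes "linear_pattern I es"
  shows "local_on I (pattern_hom E I D es)"
  unfolding local_on_def
proof (intro allI impI)
  fix \<phi> \<psi> :: "'a \<Rightarrow> 'b" assume eq: "\<forall>i\<in>I. \<phi> i = \<psi> i"
  have "pattern_edge E \<phi> e = pattern_edge E \<psi> e" if "e \<in> set es" for e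
  proof -
    obtain a b c where e: "e = (a, b, c)" by (cases e)
    show ?thesis
      using linear_pattern_edge[OF assms, of a b c] that eq by (simp add: e pattern_edge_def)
  qed
  then show "pattern_hom E I D es \<phi> = pattern_hom E I D es \<psi>"
    unfolding pattern_hom_def using eq by simp
qed

text \<open>The three endpoints are distinct, so each can be replaced by its twin independently of
  the others; \<open>C\<close> collects the replaced ones.\<close>

lemma blow_up_pattern_edge:
  assumes "blow_up q J (pattern_hom E I D es) \<phi>" and "(a, b, c) \<in> set es" "linear_pattern I es"
    and "a' = a \<or> a' = a + q \<and> a \<in> J" "b' = b \<or> b' = b + q \<and> b \<in> J" "c' = c \<or> c' = c + q \<and> c \<in> J"
  shows "{\<phi> a', \<phi> b', \<phi> c'} \<in> E"
proof -
  define C where "C = {i. i = a \<and> a' \<noteq> a \<or> i = b \<and> b' \<noteq> b \<or> i = c \<and> c' \<noteq> c}"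
  have "C \<subseteq> J" using assms(4-6) by (auto simp: C_def)
  then have "pattern_edge E (\<lambda>i. \<phi> (if i \<in> C then i + q else i)) (a, b, c)"
    using assms(1,2) unfolding blow_up_def pattern_hom_def by blast
  moreover have "a \<noteq> b" "a \<noteq> c" "b \<noteq> c" using linear_pattern_edge[OF assms(3,2)] by auto
  then have "a \<in> C \<longleftrightarrow> a' \<noteq> a" "b \<in> C \<longleftrightarrow> b' \<noteq> b" "c \<in> C \<longleftrightarrow> c' \<noteq> c"
    by (auto simp: C_def)
  then have "(if a \<in> C then a + q else a) = a'" "(if b \<in> C then b + q else b) = b'"
      "(if c \<in> C then c + q else c) = c'"
    using assms(4-6) by auto
  ultimately show ?thesis by (simp only: pattern_edge_def case_prod_conv)
qed

lemma blow_up_pattern_domain: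
  assumes "blow_up q J (pattern_hom E I D es) \<phi>" "i \<in> I" "i' = i \<or> i' = i + q \<and> i \<in> J"
  shows "\<phi> i' \<in> D i"
proof -
  have "{j. j = i \<and> i' \<noteq> i} \<subseteq> J" using assms(3) by auto
  then have "\<phi> (if i \<in> {j. j = i \<and> i' \<noteq> i} then i + q else i) \<in> D i"
    using assms(1,2) unfolding blow_up_def pattern_hom_def by blast
  moreover have "(if i \<in> {j. j = i \<and> i' \<noteq> i} then i + q else i) = i'" using assms(3) by auto
  ultimately show ?thesis by simp
qed

context weakly_quasirandom
begin

text \<open>By the last hypothesis the accumulated error is at most half of the main term, which is
  why the density is halved before the blow-up.\<close>

lemma hom_count_blow_up_pattern:
  assumes I: "finite I" "J \<subseteq> I" "I \<subseteq> {..<q}" and es: "linear_pattern I es"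
    and "0 \<le> p" "p \<le> 1" "0 \<le> \<mu>" and D: "\<And>i. i \<in> I \<Longrightarrow> D i \<subseteq> V"
    and d: "0 \<le> d" "d * real (card V) ^ card I \<le> (\<Prod>i\<in>I. real (card (D i)))"
    and \<mu>: "real (length es) * \<mu> \<le> p ^ length es * d / 2"
  shows "(p ^ length es * d / 2) ^ (2 ^ card J) * real (card V) ^ (card I + card J)
    \<le> hom_count (I \<union> (\<lambda>a. a + q) ` J) V (blow_up q J (pattern_hom E I D es))"
proof (rule hom_count_blow_up[OF I(1) finite_V finite_subset[OF I(2,1)] I(2,3) local_on_pattern_hom[OF es]])
  show "0 \<le> p ^ length es * d / 2" using \<open>0 \<le> p\<close> d by simp
  have "p ^ length es * d / 2 * real (card V) ^ card I
      \<le> (p ^ length es * d - real (length es) * \<mu>) * real (card V) ^ card I"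
  proof (rule mult_right_mono)
    show "p ^ length es * d / 2 \<le> p ^ length es * d - real (length es) * \<mu>" using \<mu> by linarith
  qed simp
  also have "\<dots> \<le> hom_count I V (\<lambda>\<phi>. (\<forall>i\<in>I. \<phi> i \<in> D i) \<and> (\<forall>e\<in>set es. pattern_edge E \<phi> e))"
    using assms hom_count_box[OF I(1), of D V] finite_V
    by (intro hom_count_linear_pattern) auto
  finally show "p ^ length es * d / 2 * real (card V) ^ card I \<le> hom_count I V (pattern_hom E I D es)"
    by (simp add: pattern_hom_def[abs_def])
qed

text \<open>For n \<ge> 2 the binomial coefficient is at least n^2/4, and every edge through
  \<open>w\<close> yields at least one ordered pair.\<close>

lemma hom_count_link:
  assumes E: "three_graph V E" and w: "w \<in> V" and "card V \<ge> 2" "0 \<le> \<alpha>"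
    and deg: "\<alpha> * real (card V choose 2) \<le> real (vertex_degree E w)"
  shows "\<alpha> / 4 * real (card V) ^ 2 \<le> hom_count {0, 1::nat} V (\<lambda>\<phi>. {w, \<phi> 0, \<phi> 1} \<in> E)"
proof -
  let ?n = "real (card V)" and ?S = "{\<phi> \<in> {0, 1::nat} \<rightarrow>\<^sub>E V. {w, \<phi> 0, \<phi> 1} \<in> E}"
  have fin: "finite ({0, 1::nat} \<rightarrow>\<^sub>E V)" using finite_V by (intro finite_PiE) auto
  have "real (card V choose 2) = ?n * (?n - 1) / 2"
    using \<open>card V \<ge> 2\<close> by (simp add: choose_two real_of_nat_div of_nat_diff)
  moreover have "?n * (?n / 2) \<le> ?n * (?n - 1)"
    using \<open>card V \<ge> 2\<close> by (intro mult_left_mono) auto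
  ultimately have "?n ^ 2 / 4 \<le> real (card V choose 2)" by (simp add: power2_eq_square)
  from mult_left_mono[OF this \<open>0 \<le> \<alpha>\<close>] have "\<alpha> / 4 * ?n ^ 2 \<le> \<alpha> * real (card V choose 2)" by simp
  also have "\<dots> \<le> real (vertex_degree E w)" by (rule deg)
  also have "vertex_degree E w \<le> card ((\<lambda>\<phi>. {w, \<phi> 0, \<phi> 1}) ` ?S)"
    unfolding vertex_degree_def
  proof (rule card_mono)
    show "{e \<in> E. w \<in> e} \<subseteq> (\<lambda>\<phi>. {w, \<phi> 0, \<phi> 1}) ` ?S"
    proof
      fix e assume e: "e \<in> {e \<in> E. w \<in> e}"
      then have "e \<subseteq> V" "card e = 3" using E by (auto simp: three_graph_def)
      then have "card (e - {w}) = 2" using e by (simp add: card_Diff_singleton)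
      then obtain x y where xy: "e - {w} = {x, y}" by (meson card_2_iff)
      let ?\<phi> = "\<lambda>i\<in>{0, 1::nat}. if i = 0 then x else y"
      have "e = {w, ?\<phi> 0, ?\<phi> 1}" using e xy by auto
      moreover have "?\<phi> \<in> {0, 1} \<rightarrow>\<^sub>E V" using xy \<open>e \<subseteq> V\<close> by (intro PiE_I) auto
      ultimately have "?\<phi> \<in> ?S" using e by simp
      with \<open>e = {w, ?\<phi> 0, ?\<phi> 1}\<close> show "e \<in> (\<lambda>\<phi>. {w, \<phi> 0, \<phi> 1}) ` ?S" by (rule image_eqI)
    qed
  qed (use fin in auto)
  also have "\<dots> \<le> card ?S" using fin by (intro card_image_le) auto
  also have "real (card ?S) = hom_count {0, 1::nat} V (\<lambda>\<phi>. {w, \<phi> 0, \<phi> 1} \<in> E)"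
    unfolding hom_count_def using fin by (simp add: of_bool_def sum.If_cases Int_def)
  finally show ?thesis by simp
qed

end

text \<open>The list \<open>is\<close> reads a homomorphism as \<open>x\<close>, \<open>y\<close>
  and the common tuple \<open>Q\<close>. It lists all of \<open>I\<close>, so different
  homomorphisms give different triples.\<close>

lemma (in tile_system) hom_count_le_sum_swaps:
  assumes "finite I" "I = set is" "X \<subseteq> V" "Y \<subseteq> V"
    and map: "\<And>\<phi>. \<phi> \<in> I \<rightarrow>\<^sub>E V \<Longrightarrow> P \<phi> \<Longrightarrow>
      \<exists>x\<in>X. \<exists>y\<in>Y. \<exists>Q\<in>swaps s {#x#} {#y#}. map \<phi> is = x # y # Q"
  shows "hom_count I V P \<le> (\<Sum>x\<in>X. \<Sum>y\<in>Y. real (card (swaps s {#x#} {#y#})))"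
proof -
  let ?T = "SIGMA x:X. SIGMA y:Y. swaps s {#x#} {#y#}"
  have fin: "finite X" "finite Y" using assms finite_V finite_subset by auto
  then have finT: "finite ?T" using finite_swaps by auto
  have "hom_count I V P \<le> real (card ((\<lambda>(x, y, Q). x # y # Q) ` ?T))"
  proof (rule hom_count_le_card[OF assms(1) finite_V assms(2)])
    fix \<phi> assume "\<phi> \<in> I \<rightarrow>\<^sub>E V" "P \<phi>"
    from map[OF this] obtain x y Q
      where "x \<in> X" "y \<in> Y" "Q \<in> swaps s {#x#} {#y#}" "map \<phi> is = x # y # Q"
      by (elim bexE)
    then show "map \<phi> is \<in> (\<lambda>(x, y, Q). x # y # Q) ` ?T"
      by (intro image_eqI[of _ _ "(x, y, Q)"]) auto
  qed (use finT in simp)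
  also have "\<dots> \<le> real (card ?T)" using finT by (simp add: card_image_le)
  also have "\<dots> = (\<Sum>x\<in>X. \<Sum>y\<in>Y. real (card (swaps s {#x#} {#y#})))"
    using fin finite_swaps by (simp add: card_SigmaI)
  finally show ?thesis .
qed

section \<open>Cherries and \<open>C\<^sub>4(2+1)\<close>\<close>

text \<open>The vertices \<open>x\<close> and \<open>x'\<close> may coincide, since a homomorphism
  of a blow-up may identify twins.\<close>

definition cherry_tile :: "'a set set \<Rightarrow> 'a multiset \<Rightarrow> bool" where
  "cherry_tile E M \<longleftrightarrow> (\<exists>x x' y z. M = {#x, x', y, z#} \<and> {x, y, z} \<in> E \<and> {x', y, z} \<in> E)"

definition C4_tile :: "'a set set \<Rightarrow> 'a multiset \<Rightarrow> bool" where
  "C4_tile E M \<longleftrightarrow> (\<exists>u v u' v' a b. M = {#u, v, u', v', a, b#} \<and>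
    {u, v, a} \<in> E \<and> {u, v, b} \<in> E \<and> {u', v', a} \<in> E \<and> {u', v', b} \<in> E)"

lemma distinct_if_count_le_1:
  assumes "\<forall>x. count (mset xs) x \<le> 1"
  shows "distinct xs"
  unfolding distinct_count_atmost_1
proof
  fix a
  have "1 \<le> count (mset xs) a" if "a \<in> set xs" using that by (simp add: Suc_le_eq)
  moreover have "count (mset xs) a = 0" if "a \<notin> set xs" using that by (simp add: count_eq_zero_iff)
  ultimately show "count (mset xs) a = (if a \<in> set xs then 1 else 0)"
    using assms[rule_format, of a] by (metis le_antisym)
qed

lemma tile_system_cherry:
  assumes "finite V"
  shows "tile_system V (cherry_tile E) (spans_copy cherry_verts cherry_edges E) 3"
proof
  fix M assume "cherry_tile E M" and M1: "\<forall>x. count M x \<le> 1"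
  then obtain x x' y z where M: "M = mset [x, x', y, z]" and E: "{x, y, z} \<in> E" "{x', y, z} \<in> E"
    by (auto simp: cherry_tile_def)
  have "distinct [x, x', y, z]" using M1 unfolding M by (rule distinct_if_count_le_1)
  then show "spans_copy cherry_verts cherry_edges E (set_mset M)"
    unfolding spans_copy_def M using E
    by (intro exI[of _ "\<lambda>i. if i = 1 then y else if i = 2 then z else if i = 3 then x else x'"])
      (auto simp: bij_betw_def inj_on_def cherry_verts_def cherry_edges_def insert_commute)
qed (use assms in \<open>auto simp: cherry_tile_def cherry_verts_def spans_copy_def dest!: bij_betw_same_card\<close>)

lemma tile_system_C4:
  assumes "finite V"
  shows "tile_system V (C4_tile E) (spans_copy C4_verts C4_edges E) 5"
proof
  fix M assume "C4_tile E M" and M1: "\<forall>x. count M x \<le> 1"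
  then obtain u v u' v' a b where M: "M = mset [u, v, u', v', a, b]"
    and E: "{u, v, a} \<in> E" "{u, v, b} \<in> E" "{u', v', a} \<in> E" "{u', v', b} \<in> E"
    by (auto simp: C4_tile_def)
  have "distinct [u, v, u', v', a, b]" using M1 unfolding M by (rule distinct_if_count_le_1)
  then show "spans_copy C4_verts C4_edges E (set_mset M)"
    unfolding spans_copy_def M using E
    by (intro exI[of _ "\<lambda>i. if i = 1 then u else if i = 2 then v else if i = 3 then u' else
        if i = 4 then v' else if i = 5 then a else b"])
      (auto simp: bij_betw_def inj_on_def C4_verts_def C4_edges_def insert_commute)
qed (use assms in \<open>auto simp: C4_tile_def C4_verts_def spans_copy_def dest!: bij_betw_same_card\<close>)

lemma has_perfect_packing_iff_packable:
  assumes "tile_system V tile (spans_copy VF EF E) r"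
  shows "has_perfect_packing VF EF V E \<longleftrightarrow> tile_system.packable (spans_copy VF EF E) V"
  unfolding has_perfect_packing_def tile_system.packable_def[OF assms] ..

section \<open>Exchanges and tile counts for the two 3-graphs\<close>

context weakly_quasirandom
begin

context
  assumes p: "0 < p" "p \<le> 1" and \<mu>: "0 \<le> \<mu>"
begin

text \<open>Take the edge 012 with 0 in \<open>X\<close> and 1 in \<open>Y\<close>, and twins 3 of 0
  and 4 of 1. Then 342 is an edge, and adding either 0, a twin of 3, or 1, a twin of 4, makes it a
  cherry. Two doublings give the exponent 4 = 2^2.\<close>

lemma cherry_swaps:
  assumes \<delta>: "\<delta> > 0" "\<mu> \<le> p * \<delta>\<^sup>2 / 2" and XY: "X \<subseteq> V" "Y \<subseteq> V"
    and X: "real (card X) \<ge> \<delta> * real (card V)" and Y: "real (card Y) \<ge> \<delta> * real (card V)"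
  shows "(p * \<delta>\<^sup>2 / 2) ^ 4 * real (card V) ^ 5
    \<le> (\<Sum>x\<in>X. \<Sum>y\<in>Y. real (card (tile_system.swaps V (cherry_tile E) 3 {#x#} {#y#})))"
proof -
  interpret tile_system V "cherry_tile E" "spans_copy cherry_verts cherry_edges E" 3
    by (rule tile_system_cherry[OF finite_V])
  let ?n = "real (card V)"
  define I J where "I = {0, 1, 2::nat}" and "J = {0, 1::nat}"
  define D where "D i = (if i = 0 then X else if i = 1 then Y else V)" for i :: nat
  define es where "es = [(0::nat, 1::nat, 2::nat)]"
  have es: "linear_pattern I es" by (simp add: I_def es_def)
  have cI: "card I = 3" "card J = 2" by (simp_all add: I_def J_def)
  have "\<delta>\<^sup>2 * ?n ^ card I = (\<delta> * ?n) * (\<delta> * ?n) * ?n"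
    by (simp add: cI power2_eq_square power3_eq_cube)
  also have "\<dots> \<le> real (card X) * real (card Y) * ?n"
    using X Y \<delta> by (intro mult_mono) auto
  also have "\<dots> = (\<Prod>i\<in>I. real (card (D i)))" by (simp add: I_def D_def)
  finally have "(p ^ length es * \<delta>\<^sup>2 / 2) ^ (2 ^ card J) * ?n ^ (card I + card J)
      \<le> hom_count (I \<union> (\<lambda>a. a + 3) ` J) V (blow_up 3 J (pattern_hom E I D es))"
    using p \<mu> \<delta> XY es
    by (intro hom_count_blow_up_pattern) (auto simp: I_def J_def D_def es_def)
  also have "\<dots> \<le> (\<Sum>x\<in>X. \<Sum>y\<in>Y. real (card (swaps 3 {#x#} {#y#})))"
  proof (rule hom_count_le_sum_swaps[OF _ _ XY])
    show "I \<union> (\<lambda>a. a + 3) ` J = set [0, 1, 3, 4, 2]" by (auto simp: I_def J_def)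
    fix \<phi> assume \<phi>: "\<phi> \<in> (I \<union> (\<lambda>a. a + 3) ` J) \<rightarrow>\<^sub>E V"
      and bl: "blow_up 3 J (pattern_hom E I D es) \<phi>"
    have edge: "{\<phi> a, \<phi> b, \<phi> 2} \<in> E" if "a \<in> {0, 3}" "b \<in> {1, 4}" for a b
      by (rule blow_up_pattern_edge[OF bl _ es, of 0 1 2]) (use that in \<open>auto simp: es_def J_def\<close>)
    have "cherry_tile E {#\<phi> 0, \<phi> 3, \<phi> 4, \<phi> 2#}" "cherry_tile E {#\<phi> 1, \<phi> 4, \<phi> 3, \<phi> 2#}"
      unfolding cherry_tile_def using edge[of 0 4] edge[of 3 4] edge[of 3 1]
      by (force simp: insert_commute)+
    then have "tileable {#\<phi> 0, \<phi> 3, \<phi> 4, \<phi> 2#}" "tileable {#\<phi> 1, \<phi> 3, \<phi> 4, \<phi> 2#}"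
      using tileable_tile by (auto simp: add_mset_commute)
    moreover have "\<phi> 3 \<in> V" "\<phi> 4 \<in> V" "\<phi> 2 \<in> V" using \<phi> by (auto simp: I_def J_def PiE_iff)
    ultimately have "[\<phi> 3, \<phi> 4, \<phi> 2] \<in> swaps 3 {#\<phi> 0#} {#\<phi> 1#}"
      by (simp add: swaps_def tuples_def)
    moreover have "\<phi> 0 \<in> D 0" "\<phi> 1 \<in> D 1"
      by (rule blow_up_pattern_domain[OF bl]; simp add: I_def)+
    ultimately show "\<exists>x\<in>X. \<exists>y\<in>Y. \<exists>Q\<in>swaps 3 {#x#} {#y#}. map \<phi> [0, 1, 3, 4, 2] = x # y # Q"
      by (auto simp: D_def)
  qed (auto simp: I_def J_def)
  finally show ?thesis by (simp add: cI es_def)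
qed

lemma cherry_tiles:
  assumes \<delta>: "\<delta> > 0" "\<mu> \<le> p * \<delta> ^ 3 / 2" and "X \<subseteq> V"
    and X: "real (card X) \<ge> \<delta> * real (card V)"
  shows "(p * \<delta> ^ 3 / 2)\<^sup>2 * real (card V) ^ 4 \<le> real (card {xs \<in> tuples X 4. cherry_tile E (mset xs)})"
proof -
  let ?n = "real (card V)"
  define I J where "I = {0, 1, 2::nat}" and "J = {0::nat}"
  define es where "es = [(0::nat, 1::nat, 2::nat)]"
  have es: "linear_pattern I es" by (simp add: I_def es_def)
  have cI: "card I = 3" "card J = 1" by (simp_all add: I_def J_def)
  have "\<delta> ^ 3 * ?n ^ card I = (\<delta> * ?n) ^ 3" by (simp add: cI power_mult_distrib)
  also have "\<dots> \<le> real (card X) ^ 3" using X \<delta> by (intro power_mono) auto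
  also have "\<dots> = (\<Prod>i\<in>I. real (card X))" by (simp add: I_def power3_eq_cube)
  finally have "(p ^ length es * \<delta> ^ 3 / 2) ^ (2 ^ card J) * ?n ^ (card I + card J)
      \<le> hom_count (I \<union> (\<lambda>a. a + 3) ` J) V (blow_up 3 J (pattern_hom E I (\<lambda>_. X) es))"
    using p \<mu> \<delta> es \<open>X \<subseteq> V\<close>
    by (intro hom_count_blow_up_pattern) (auto simp: I_def J_def es_def)
  also have "\<dots> \<le> real (card {xs \<in> tuples X 4. cherry_tile E (mset xs)})"
  proof (rule hom_count_le_card[OF _ finite_V])
    show "I \<union> (\<lambda>a. a + 3) ` J = set [0, 3, 1, 2]" by (auto simp: I_def J_def)
    fix \<phi> assume bl: "blow_up 3 J (pattern_hom E I (\<lambda>_. X) es) \<phi>"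
    have edge: "{\<phi> a, \<phi> 1, \<phi> 2} \<in> E" if "a \<in> {0, 3}" for a
      by (rule blow_up_pattern_edge[OF bl _ es, of 0 1 2]) (use that in \<open>auto simp: es_def J_def\<close>)
    have "cherry_tile E (mset (map \<phi> [0, 3, 1, 2]))"
      unfolding cherry_tile_def using edge[of 0] edge[of 3] by auto
    moreover have "\<phi> 0 \<in> X" "\<phi> 1 \<in> X" "\<phi> 2 \<in> X" "\<phi> 3 \<in> X"
      using blow_up_pattern_domain[OF bl, of 0 0] blow_up_pattern_domain[OF bl, of 1 1]
        blow_up_pattern_domain[OF bl, of 2 2] blow_up_pattern_domain[OF bl, of 0 3]
      by (auto simp: I_def J_def)
    ultimately show "map \<phi> [0, 3, 1, 2] \<in> {xs \<in> tuples X 4. cherry_tile E (mset xs)}"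
      by (simp add: tuples_def)
  qed (use finite_tuples[OF finite_subset[OF \<open>X \<subseteq> V\<close> finite_V]] in \<open>auto simp: I_def J_def\<close>)
  finally show ?thesis by (simp add: cI es_def)
qed

text \<open>An edge in the link of \<open>w\<close>, doubled at one end, gives two edges that share
  \<open>w\<close> and the other end.\<close>

lemma cherry_tiles_at:
  assumes "three_graph V E" "w \<in> V" "card V \<ge> 2" "0 \<le> \<alpha>"
    and "\<alpha> * real (card V choose 2) \<le> real (vertex_degree E w)"
  shows "(\<alpha> / 4)\<^sup>2 * real (card V) ^ 3 \<le> real (card {Q \<in> tuples V 3. cherry_tile E (add_mset w (mset Q))})"
proof -
  let ?P = "\<lambda>\<phi>. {w, \<phi> 0, \<phi> 1} \<in> E"
  have "(\<alpha> / 4) ^ (2 ^ card {0::nat}) * real (card V) ^ (card {0, 1::nat} + card {0::nat})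
      \<le> hom_count ({0, 1} \<union> (\<lambda>a. a + 2) ` {0}) V (blow_up 2 {0} ?P)"
    using hom_count_link[OF assms] finite_V \<open>0 \<le> \<alpha>\<close>
    by (intro hom_count_blow_up) (auto simp: local_on_def numeral_2_eq_2)
  also have "\<dots> \<le> real (card {Q \<in> tuples V 3. cherry_tile E (add_mset w (mset Q))})"
  proof (rule hom_count_le_card[OF _ finite_V])
    show "{0, 1} \<union> (\<lambda>a. a + 2) ` {0} = set [0, 2, 1::nat]" by auto
    fix \<phi> assume \<phi>: "\<phi> \<in> ({0, 1} \<union> (\<lambda>a. a + 2) ` {0}) \<rightarrow>\<^sub>E V" and bl: "blow_up 2 {0} ?P \<phi>"
    have "{w, \<phi> 0, \<phi> 1} \<in> E" "{w, \<phi> 2, \<phi> 1} \<in> E"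
      using bl[unfolded blow_up_def, rule_format, of "{}"] bl[unfolded blow_up_def, rule_format, of "{0}"]
      by (auto simp: numeral_2_eq_2)
    then have "{\<phi> 0, \<phi> 1, w} \<in> E" "{\<phi> 2, \<phi> 1, w} \<in> E" by (auto simp: insert_commute)
    moreover have "add_mset w (mset (map \<phi> [0, 2, 1])) = {#\<phi> 0, \<phi> 2, \<phi> 1, w#}" by simp
    ultimately have "cherry_tile E (add_mset w (mset (map \<phi> [0, 2, 1])))"
      unfolding cherry_tile_def by blast
    then show "map \<phi> [0, 2, 1] \<in> {Q \<in> tuples V 3. cherry_tile E (add_mset w (mset Q))}"
      using \<phi> by (simp add: tuples_def PiE_iff numeral_2_eq_2)
  qed (use finite_tuples[OF finite_V] in auto)
  finally show ?thesis by (simp add: numeral_3_eq_3)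
qed

text \<open>The pattern consists of the rows 123, 456, 780 and the columns 147, 258, 369 of a grid, the corner being
  split into 0 and 9. Two edges meeting in one vertex form a degenerate tile, as does an edge taken twice.
  So \<open>Q\<close>, which is twice the three columns with one 9 removed, is tiled together with 9 by columns and
  together with 0 by three pairs of a row and a column.\<close>

lemma C4_swaps:
  assumes \<delta>: "\<delta> > 0" "6 * \<mu> \<le> p ^ 6 * \<delta>\<^sup>2 / 2" and XY: "X \<subseteq> V" "Y \<subseteq> V"
    and X: "real (card X) \<ge> \<delta> * real (card V)" and Y: "real (card Y) \<ge> \<delta> * real (card V)"
  shows "(p ^ 6 * \<delta>\<^sup>2 / 2) ^ (2 ^ 9) * real (card V) ^ 19
    \<le> (\<Sum>x\<in>X. \<Sum>y\<in>Y. real (card (tile_system.swaps V (C4_tile E) 17 {#x#} {#y#})))"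
proof -
  interpret tile_system V "C4_tile E" "spans_copy C4_verts C4_edges E" 5
    by (rule tile_system_C4[OF finite_V])
  let ?n = "real (card V)"
  \<comment> \<open>Vertex 0 needs no twin, as it is covered only once and does not occur in
    \<open>Q\<close>. The 10 + 9 vertices without 0 and 9 are the 17 entries of
    \<open>Q\<close>.\<close>
  define I J where "I = {0, 1, 2, 3, 4, 5, 6, 7, 8, 9::nat}" and "J = {1, 2, 3, 4, 5, 6, 7, 8, 9::nat}"
  define D where "D i = (if i = 0 then X else if i = 9 then Y else V)" for i :: nat
  define es where "es = [(1::nat, 2::nat, 3::nat), (4, 5, 6), (7, 8, 0), (1, 4, 7), (2, 5, 8), (3, 6, 9)]"
  have es: "linear_pattern I es" by (simp add: I_def es_def)
  have cI: "card I = 10" "card J = 9" "length es = 6" by (simp_all add: I_def J_def es_def)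
  have "\<delta>\<^sup>2 * ?n ^ card I = (\<delta> * ?n) * (\<delta> * ?n) * ?n ^ 8"
    by (simp add: cI power2_eq_square eval_nat_numeral)
  also have "\<dots> \<le> real (card X) * real (card Y) * ?n ^ 8"
    using X Y \<delta> by (intro mult_mono) auto
  also have "\<dots> = (\<Prod>i\<in>I. real (card (D i)))" by (simp add: I_def D_def eval_nat_numeral)
  finally have "(p ^ length es * \<delta>\<^sup>2 / 2) ^ (2 ^ card J) * ?n ^ (card I + card J)
      \<le> hom_count (I \<union> (\<lambda>a. a + 10) ` J) V (blow_up 10 J (pattern_hom E I D es))"
    using p \<mu> \<delta> XY es
    by (intro hom_count_blow_up_pattern) (auto simp: I_def J_def D_def cI(3))
  also have "\<dots> \<le> (\<Sum>x\<in>X. \<Sum>y\<in>Y. real (card (swaps 17 {#x#} {#y#})))"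
  proof (rule hom_count_le_sum_swaps[OF _ _ XY])
    let ?is = "[1, 2, 3, 4, 5, 6, 7, 8, 11, 12, 13, 14, 15, 16, 17, 18, 19::nat]"
    show *: "I \<union> (\<lambda>a. a + 10) ` J = set (0 # 9 # ?is)" by (auto simp: I_def J_def)
    fix \<phi> assume \<phi>: "\<phi> \<in> (I \<union> (\<lambda>a. a + 10) ` J) \<rightarrow>\<^sub>E V"
      and bl: "blow_up 10 J (pattern_hom E I D es) \<phi>"
    have edge: "{\<phi> a', \<phi> b', \<phi> c'} \<in> E"
      if "(a, b, c) \<in> set es" "a' = a \<or> a' = a + 10 \<and> a \<in> J" "b' = b \<or> b' = b + 10 \<and> b \<in> J"
        "c' = c \<or> c' = c + 10 \<and> c \<in> J" for a b c a' b' c'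
      by (rule blow_up_pattern_edge[OF bl that(1) es that(2-4)])
    have tile: "C4_tile E {#\<phi> u, \<phi> v, \<phi> u', \<phi> v', \<phi> a, \<phi> b#}"
      if "{\<phi> u, \<phi> v, \<phi> a} \<in> E" "{\<phi> u, \<phi> v, \<phi> b} \<in> E" "{\<phi> u', \<phi> v', \<phi> a} \<in> E" "{\<phi> u', \<phi> v', \<phi> b} \<in> E"
      for u v u' v' a b
      unfolding C4_tile_def using that by blast
    have 147: "{\<phi> a, \<phi> b, \<phi> c} \<in> E" if "a \<in> {1, 11}" "b \<in> {4, 14}" "c \<in> {7, 17}" for a b c
      by (rule edge[of 1 4 7]) (use that in \<open>auto simp: es_def J_def\<close>)
    have 258: "{\<phi> a, \<phi> b, \<phi> c} \<in> E" if "a \<in> {2, 12}" "b \<in> {5, 15}" "c \<in> {8, 18}" for a b c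
      by (rule edge[of 2 5 8]) (use that in \<open>auto simp: es_def J_def\<close>)
    have 369: "{\<phi> a, \<phi> b, \<phi> c} \<in> E" if "a \<in> {3, 13}" "b \<in> {6, 16}" "c \<in> {9, 19}" for a b c
      by (rule edge[of 3 6 9]) (use that in \<open>auto simp: es_def J_def\<close>)
    have 123: "{\<phi> a, \<phi> b, \<phi> c} \<in> E" if "a \<in> {1, 11}" "b \<in> {2, 12}" "c \<in> {3, 13}" for a b c
      by (rule edge[of 1 2 3]) (use that in \<open>auto simp: es_def J_def\<close>)
    have 456: "{\<phi> a, \<phi> b, \<phi> c} \<in> E" if "a \<in> {4, 14}" "b \<in> {5, 15}" "c \<in> {6, 16}" for a b c
      by (rule edge[of 4 5 6]) (use that in \<open>auto simp: es_def J_def\<close>)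
    have 780: "{\<phi> a, \<phi> b, \<phi> 0} \<in> E" if "a \<in> {7, 17}" "b \<in> {8, 18}" for a b
      by (rule edge[of 7 8 0]) (use that in \<open>auto simp: es_def J_def\<close>)
    \<comment> \<open>A column taken twice: 7 and its twin 17 both complete the pair 1, 4 and the
      twin pair 11, 14.\<close>
    have "C4_tile E {#\<phi> 1, \<phi> 4, \<phi> 11, \<phi> 14, \<phi> 7, \<phi> 17#}"
      by (rule tile) (simp_all add: 147)
    moreover have "C4_tile E {#\<phi> 2, \<phi> 5, \<phi> 12, \<phi> 15, \<phi> 8, \<phi> 18#}"
      by (rule tile) (simp_all add: 258)
    moreover have "C4_tile E {#\<phi> 3, \<phi> 6, \<phi> 13, \<phi> 16, \<phi> 9, \<phi> 19#}"
      by (rule tile) (simp_all add: 369)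
    ultimately have "tileable ({#\<phi> 1, \<phi> 4, \<phi> 11, \<phi> 14, \<phi> 7, \<phi> 17#} + ({#\<phi> 2, \<phi> 5, \<phi> 12, \<phi> 15, \<phi> 8, \<phi> 18#} +
        {#\<phi> 3, \<phi> 6, \<phi> 13, \<phi> 16, \<phi> 9, \<phi> 19#}))"
      by (intro tileable_add_tile tileable_tile)
    also have "{#\<phi> 1, \<phi> 4, \<phi> 11, \<phi> 14, \<phi> 7, \<phi> 17#} + ({#\<phi> 2, \<phi> 5, \<phi> 12, \<phi> 15, \<phi> 8, \<phi> 18#} +
        {#\<phi> 3, \<phi> 6, \<phi> 13, \<phi> 16, \<phi> 9, \<phi> 19#}) = {#\<phi> 9#} + mset (map \<phi> ?is)"
      by (simp add: add_mset_commute)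
    finally have columns: "tileable ({#\<phi> 9#} + mset (map \<phi> ?is))" .
    have "{\<phi> b, \<phi> 0, \<phi> a} \<in> E" if "a \<in> {7, 17}" "b \<in> {8, 18}" for a b
      using 780[OF that] by (simp add: insert_commute)
    \<comment> \<open>Column 147 and row 780 meet in 7, the doubled vertex of this tile. The other
      two tiles pair column 258 with row 123 at 2, and column 369 with row 456 at 6.\<close>
    then have "C4_tile E {#\<phi> 1, \<phi> 4, \<phi> 8, \<phi> 0, \<phi> 7, \<phi> 17#}"
      by (intro tile) (simp_all add: 147)
    moreover have "{\<phi> a, \<phi> c, \<phi> b} \<in> E" if "a \<in> {1, 11}" "b \<in> {2, 12}" "c \<in> {3, 13}" for a b c
      using 123[OF that] by (simp add: insert_commute)
    moreover have "{\<phi> b, \<phi> c, \<phi> a} \<in> E" if "a \<in> {2, 12}" "b \<in> {5, 15}" "c \<in> {8, 18}" for a b c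
      using 258[OF that] by (simp add: insert_commute)
    ultimately have "C4_tile E {#\<phi> 1, \<phi> 4, \<phi> 8, \<phi> 0, \<phi> 7, \<phi> 17#}"
        "C4_tile E {#\<phi> 5, \<phi> 18, \<phi> 11, \<phi> 3, \<phi> 2, \<phi> 12#}"
      by (blast, intro tile) simp_all
    moreover have "{\<phi> a, \<phi> c, \<phi> b} \<in> E" if "a \<in> {3, 13}" "b \<in> {6, 16}" "c \<in> {9, 19}" for a b c
      using 369[OF that] by (simp add: insert_commute)
    then have "C4_tile E {#\<phi> 13, \<phi> 19, \<phi> 14, \<phi> 15, \<phi> 6, \<phi> 16#}"
      by (intro tile) (simp_all add: 456)
    ultimately have "tileable ({#\<phi> 1, \<phi> 4, \<phi> 8, \<phi> 0, \<phi> 7, \<phi> 17#} + ({#\<phi> 5, \<phi> 18, \<phi> 11, \<phi> 3, \<phi> 2, \<phi> 12#} +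
        {#\<phi> 13, \<phi> 19, \<phi> 14, \<phi> 15, \<phi> 6, \<phi> 16#}))"
      by (intro tileable_add_tile tileable_tile)
    also have "{#\<phi> 1, \<phi> 4, \<phi> 8, \<phi> 0, \<phi> 7, \<phi> 17#} + ({#\<phi> 5, \<phi> 18, \<phi> 11, \<phi> 3, \<phi> 2, \<phi> 12#} +
        {#\<phi> 13, \<phi> 19, \<phi> 14, \<phi> 15, \<phi> 6, \<phi> 16#}) = {#\<phi> 0#} + mset (map \<phi> ?is)"
      by (simp add: add_mset_commute)
    finally have rows: "tileable ({#\<phi> 0#} + mset (map \<phi> ?is))" .
    have "set (map \<phi> ?is) \<subseteq> V" using \<phi> unfolding * by (auto simp: PiE_iff)
    moreover have "length (map \<phi> ?is) = 17" by simp
    ultimately have "map \<phi> ?is \<in> swaps 17 {#\<phi> 0#} {#\<phi> 9#}"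
      using rows columns unfolding swaps_def tuples_def by blast
    moreover have "\<phi> 0 \<in> D 0" "\<phi> 9 \<in> D 9"
      by (rule blow_up_pattern_domain[OF bl]; simp add: I_def)+
    ultimately show "\<exists>x\<in>X. \<exists>y\<in>Y. \<exists>Q\<in>swaps 17 {#x#} {#y#}. map \<phi> (0 # 9 # ?is) = x # y # Q"
      unfolding list.map(2) by (intro bexI[of _ "\<phi> 0"] bexI[of _ "\<phi> 9"] bexI[of _ "map \<phi> ?is"] refl) (simp_all add: D_def)
  qed (auto simp: I_def J_def)
  finally show ?thesis by (simp add: cI)
qed

text \<open>Two edges through vertex 4 form a linear pattern; 4 and its twin 9 are the vertices
  \<open>a\<close> and \<open>b\<close> of the tile.\<close>

lemma C4_tiles:
  assumes \<delta>: "\<delta> > 0" "2 * \<mu> \<le> p\<^sup>2 * \<delta> ^ 5 / 2" and "X \<subseteq> V"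
    and X: "real (card X) \<ge> \<delta> * real (card V)"
  shows "(p\<^sup>2 * \<delta> ^ 5 / 2)\<^sup>2 * real (card V) ^ 6 \<le> real (card {xs \<in> tuples X 6. C4_tile E (mset xs)})"
proof -
  let ?n = "real (card V)"
  define I J where "I = {0, 1, 2, 3, 4::nat}" and "J = {4::nat}"
  define es where "es = [(0::nat, 1::nat, 4::nat), (2, 3, 4)]"
  have es: "linear_pattern I es" by (simp add: I_def es_def)
  have cI: "card I = 5" "card J = 1" by (simp_all add: I_def J_def)
  have "\<delta> ^ 5 * ?n ^ card I = (\<delta> * ?n) ^ 5" by (simp add: cI power_mult_distrib)
  also have "\<dots> \<le> real (card X) ^ 5" using X \<delta> by (intro power_mono) auto
  also have "\<dots> = (\<Prod>i\<in>I. real (card X))" by (simp add: cI)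
  finally have "(p ^ length es * \<delta> ^ 5 / 2) ^ (2 ^ card J) * ?n ^ (card I + card J)
      \<le> hom_count (I \<union> (\<lambda>a. a + 5) ` J) V (blow_up 5 J (pattern_hom E I (\<lambda>_. X) es))"
    using p \<mu> \<delta> es \<open>X \<subseteq> V\<close>
    by (intro hom_count_blow_up_pattern) (auto simp: I_def J_def es_def power2_eq_square)
  also have "\<dots> \<le> real (card {xs \<in> tuples X 6. C4_tile E (mset xs)})"
  proof (rule hom_count_le_card[OF _ finite_V])
    show "I \<union> (\<lambda>a. a + 5) ` J = set [0, 1, 2, 3, 4, 9]" by (auto simp: I_def J_def)
    fix \<phi> assume bl: "blow_up 5 J (pattern_hom E I (\<lambda>_. X) es) \<phi>"
    have "{\<phi> 0, \<phi> 1, \<phi> a} \<in> E" if "a \<in> {4, 9}" for a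
      by (rule blow_up_pattern_edge[OF bl _ es, of 0 1 4]) (use that in \<open>auto simp: es_def J_def\<close>)
    moreover have "{\<phi> 2, \<phi> 3, \<phi> a} \<in> E" if "a \<in> {4, 9}" for a
      by (rule blow_up_pattern_edge[OF bl _ es, of 2 3 4]) (use that in \<open>auto simp: es_def J_def\<close>)
    ultimately have "C4_tile E {#\<phi> 0, \<phi> 1, \<phi> 2, \<phi> 3, \<phi> 4, \<phi> 9#}"
      unfolding C4_tile_def by (intro exI conjI) (rule refl, simp_all)
    then have "C4_tile E (mset (map \<phi> [0, 1, 2, 3, 4, 9]))" by simp
    moreover have "\<phi> a \<in> X" if "a \<in> {0, 1, 2, 3, 4}" for a
      by (rule blow_up_pattern_domain[OF bl, of a a]) (use that in \<open>auto simp: I_def\<close>)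
    moreover have "\<phi> 9 \<in> X"
      by (rule blow_up_pattern_domain[OF bl, of 4 9]) (auto simp: I_def J_def)
    ultimately show "map \<phi> [0, 1, 2, 3, 4, 9] \<in> {xs \<in> tuples X 6. C4_tile E (mset xs)}"
      by (simp add: tuples_def)
  qed (use finite_tuples[OF finite_subset[OF \<open>X \<subseteq> V\<close> finite_V]] in \<open>auto simp: I_def J_def\<close>)
  finally show ?thesis by (simp add: cI es_def power2_eq_square)
qed

text \<open>The pairs of the tile are \<open>w\<close>, 0 and 2, 3, and \<open>a\<close>,
  \<open>b\<close> are 1 and its twin 5. The degree condition gives the edge through
  \<open>w\<close>; for fixed 0 it only restricts 1, so the choices of 1, 2, 3 form a box in which
  the second edge can be counted. Half of the main term p * \<alpha> / 4 pays for the error.\<close>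

lemma C4_tiles_at:
  assumes "three_graph V E" "w \<in> V" "card V \<ge> 2" "0 \<le> \<alpha>"
    and "\<alpha> * real (card V choose 2) \<le> real (vertex_degree E w)"
    and "\<mu> \<le> p * \<alpha> / 8"
  shows "(p * \<alpha> / 8)\<^sup>2 * real (card V) ^ 5 \<le> real (card {Q \<in> tuples V 5. C4_tile E (add_mset w (mset Q))})"
proof -
  let ?n = "real (card V)"
  define I where "I = {0, 1, 2, 3::nat}"
  define P where "P \<phi> \<longleftrightarrow> {w, \<phi> 0, \<phi> 1} \<in> E" for \<phi> :: "nat \<Rightarrow> 'a"
  define P' where "P' \<phi> \<longleftrightarrow> P \<phi> \<and> pattern_edge E \<phi> (1, 2, 3)" for \<phi>
  have cI: "card I = 4" by (simp add: I_def)
  have loc: "local_on K P" if "{0, 1} \<subseteq> K" for K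
    using that by (auto simp: local_on_def P_def)
  have "I = insert 3 (insert 2 {0, 1})" by (auto simp: I_def)
  then have "hom_count I V P = ?n * (?n * hom_count {0, 1} V P)"
    using finite_V loc by (simp add: hom_count_insert_free)
  also have "\<dots> \<ge> ?n * (?n * (\<alpha> / 4 * ?n ^ 2))"
    using hom_count_link[OF assms(1-5)] by (intro mult_left_mono) (auto simp: P_def[abs_def])
  finally have "\<alpha> / 4 * ?n ^ 4 \<le> hom_count I V P" by (simp add: eval_nat_numeral ac_simps)
  then have "p * (\<alpha> / 4 * ?n ^ 4) - \<mu> * ?n ^ 4 \<le> p * hom_count I V P - \<mu> * ?n ^ card I"
    using p by (simp add: cI)
  also have "\<dots> \<le> hom_count I V P'"
    unfolding P'_def[abs_def]
    by (rule hom_count_add_edge[where A = "\<lambda>\<phi> x. {w, \<phi> 0, x} \<in> E" and B = "\<lambda>_ _. True" and C = "\<lambda>_ _. True"])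
      (auto simp: I_def P_def)
  finally have "p * \<alpha> / 4 * ?n ^ 4 - \<mu> * ?n ^ 4 \<le> hom_count I V P'" by simp
  moreover have "\<mu> * ?n ^ 4 \<le> p * \<alpha> / 8 * ?n ^ 4"
    using assms(6) by (intro mult_right_mono) auto
  ultimately have "p * \<alpha> / 8 * ?n ^ card I \<le> hom_count I V P'" by (simp add: cI)
  then have "(p * \<alpha> / 8) ^ (2 ^ card {1::nat}) * ?n ^ (card I + card {1::nat})
      \<le> hom_count (I \<union> (\<lambda>a. a + 4) ` {1}) V (blow_up 4 {1} P')"
    using finite_V p \<open>0 \<le> \<alpha>\<close>
    by (intro hom_count_blow_up) (auto simp: I_def local_on_def P'_def P_def pattern_edge_def)
  also have "\<dots> \<le> real (card {Q \<in> tuples V 5. C4_tile E (add_mset w (mset Q))})"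
  proof (rule hom_count_le_card[OF _ finite_V])
    show *: "I \<union> (\<lambda>a. a + 4) ` {1} = set [0, 2, 3, 1, 5]" by (auto simp: I_def)
    fix \<phi> assume \<phi>: "\<phi> \<in> (I \<union> (\<lambda>a. a + 4) ` {1}) \<rightarrow>\<^sub>E V" and bl: "blow_up 4 {1} P' \<phi>"
    have "P' \<phi>" using bl[unfolded blow_up_def, rule_format, of "{}"] by simp
    moreover have "P' (\<lambda>a. \<phi> (if a \<in> {1} then a + 4 else a))"
      using bl[unfolded blow_up_def, rule_format, of "{1}"] by simp
    ultimately have "{w, \<phi> 0, \<phi> 1} \<in> E" "{w, \<phi> 0, \<phi> 5} \<in> E" "{\<phi> 2, \<phi> 3, \<phi> 1} \<in> E" "{\<phi> 2, \<phi> 3, \<phi> 5} \<in> E"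
      by (simp_all add: P'_def P_def pattern_edge_def insert_commute)
    then have "C4_tile E {#w, \<phi> 0, \<phi> 2, \<phi> 3, \<phi> 1, \<phi> 5#}"
      unfolding C4_tile_def by blast
    then have "C4_tile E (add_mset w (mset (map \<phi> [0, 2, 3, 1, 5])))" by simp
    moreover have "set (map \<phi> [0, 2, 3, 1, 5]) \<subseteq> V" using \<phi> unfolding * by (auto simp: PiE_iff)
    ultimately show "map \<phi> [0, 2, 3, 1, 5] \<in> {Q \<in> tuples V 5. C4_tile E (add_mset w (mset Q))}"
      by (simp add: tuples_def)
  qed (use finite_tuples[OF finite_V] in \<open>auto simp: I_def\<close>)
  finally show ?thesis by (simp add: cI)
qed

end

end

section \<open>Perfect packings in dense 3-graphs\<close>

lemma weakly_quasirandom_if_dense: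
  "dense_three_graph n p \<mu> \<alpha> V E \<Longrightarrow> weakly_quasirandom V E p \<mu>"
  by unfold_locales (auto simp: dense_three_graph_def three_graph_def)

lemma dense_three_graph_mono:
  assumes "dense_three_graph n p \<mu> \<alpha> V E" "\<mu> \<le> \<mu>'"
  shows "dense_three_graph n p \<mu>' \<alpha> V E"
proof -
  have "x - \<mu>' * real n ^ 3 \<le> x - \<mu> * real n ^ 3" for x
    using assms(2) by (intro diff_left_mono mult_right_mono) auto
  from order_trans[OF this] show ?thesis
    using assms(1) unfolding dense_three_graph_def by auto
qed

lemma cherry_packing:
  fixes \<alpha> p :: real
  assumes "0 < \<alpha>" "0 < p" "p \<le> 1"
  shows "\<exists>\<mu>>0. \<exists>n0. \<forall>n\<ge>n0. \<forall>(V :: 'a set) E. dense_three_graph n p \<mu> \<alpha> V E \<longrightarrow> 4 dvd n \<longrightarrow>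
    has_perfect_packing cherry_verts cherry_edges V E"
proof -
  define g where "g \<delta> = (p * \<delta>\<^sup>2 / 2) ^ 4" for \<delta>
  define h where "h \<delta> = (p * \<delta> ^ 3 / 2)\<^sup>2" for \<delta>
  have "(\<alpha> / 4)\<^sup>2 > 0" "\<And>\<delta>. \<delta> > 0 \<Longrightarrow> g \<delta> > 0" "\<And>\<delta>. \<delta> > 0 \<Longrightarrow> h \<delta> > 0"
    using assms by (simp_all add: g_def h_def)
  from packable_large[where 'a = 'a and g = g and h = h, OF this, where r = 3 and s = 3]
  obtain \<epsilon> n0 where "\<epsilon> > 0" and pack: "\<And>(V :: 'a set) tile spans. tile_system V tile spans 3 \<Longrightarrow> n0 \<le> card V \<Longrightarrow>
      abundant_tiles V tile 3 3 ((\<alpha> / 4)\<^sup>2) g h \<epsilon> \<Longrightarrow> Suc 3 dvd card V \<Longrightarrow> tile_system.packable spans V"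
    by blast
  \<comment> \<open>Both counts tolerate this error at density \<epsilon>, and for larger \<delta>
    their conditions on \<mu> only become weaker.\<close>
  define \<mu> where "\<mu> = min (p * \<epsilon>\<^sup>2 / 2) (p * \<epsilon> ^ 3 / 2)"
  have "\<mu> > 0" using assms \<open>\<epsilon> > 0\<close> by (simp add: \<mu>_def)
  have \<mu>: "\<mu> \<le> p * \<delta>\<^sup>2 / 2" "\<mu> \<le> p * \<delta> ^ 3 / 2" if "\<epsilon> \<le> \<delta>" for \<delta>
  proof -
    have "p * \<epsilon> ^ k / 2 \<le> p * \<delta> ^ k / 2" for k
      using that assms \<open>\<epsilon> > 0\<close> by (intro divide_right_mono mult_left_mono power_mono) auto
    from this[of 2] this[of 3] show "\<mu> \<le> p * \<delta>\<^sup>2 / 2" "\<mu> \<le> p * \<delta> ^ 3 / 2" by (auto simp: \<mu>_def)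
  qed
  \<comment> \<open>The 2 is required by the quadratic lower bound for the binomial coefficient in
    the link count.\<close>
  have "has_perfect_packing cherry_verts cherry_edges V E"
    if H: "dense_three_graph n p \<mu> \<alpha> V E" and n: "max n0 2 \<le> n" "4 dvd n" for n and V :: "'a set" and E
  proof -
    interpret weakly_quasirandom V E p \<mu> by (rule weakly_quasirandom_if_dense[OF H])
    have H': "three_graph V E" "card V = n" "\<And>v. v \<in> V \<Longrightarrow> \<alpha> * real (n choose 2) \<le> real (vertex_degree E v)"
      using H by (auto simp: dense_three_graph_def)
    have "abundant_tiles V (cherry_tile E) 3 3 ((\<alpha> / 4)\<^sup>2) g h \<epsilon>"
      unfolding abundant_tiles_def
    proof (intro conjI ballI allI impI)
      fix w assume "w \<in> V"
      then show "(\<alpha> / 4)\<^sup>2 * real (card V) ^ 3 \<le> real (card {Q \<in> tuples V 3. cherry_tile E (add_mset w (mset Q))})"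
        using assms \<open>\<mu> > 0\<close> H' n by (intro cherry_tiles_at) (auto simp: \<mu>_def)
    next
      fix \<delta> X assume "\<epsilon> \<le> \<delta>" "X \<subseteq> V" "\<delta> * real (card V) \<le> real (card X)"
      then have "h \<delta> * real (card V) ^ 4 \<le> real (card {xs \<in> tuples X 4. cherry_tile E (mset xs)})"
        unfolding h_def using assms \<open>\<mu> > 0\<close> \<open>\<epsilon> > 0\<close> \<mu>(2)[of \<delta>] by (intro cherry_tiles) linarith+
      then show "h \<delta> * real (card V) ^ Suc 3 \<le> real (card {xs \<in> tuples X (Suc 3). cherry_tile E (mset xs)})"
        by simp
    next
      fix \<delta> X Y assume "\<epsilon> \<le> \<delta>" "X \<subseteq> V" "Y \<subseteq> V"
        "\<delta> * real (card V) \<le> real (card X)" "\<delta> * real (card V) \<le> real (card Y)"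
      then have "g \<delta> * real (card V) ^ 5
          \<le> (\<Sum>x\<in>X. \<Sum>y\<in>Y. real (card (tile_system.swaps V (cherry_tile E) 3 {#x#} {#y#})))"
        unfolding g_def using assms \<open>\<mu> > 0\<close> \<open>\<epsilon> > 0\<close> \<mu>(1)[of \<delta>] by (intro cherry_swaps) linarith+
      then show "g \<delta> * real (card V) ^ (3 + 2)
          \<le> (\<Sum>x\<in>X. \<Sum>y\<in>Y. real (card (tile_system.swaps V (cherry_tile E) 3 {#x#} {#y#})))"
        by simp
    qed
    then have "tile_system.packable (spans_copy cherry_verts cherry_edges E) V"
      using H' n by (intro pack[OF tile_system_cherry[OF finite_V]]) auto
    then show ?thesis
      by (simp add: has_perfect_packing_iff_packable[OF tile_system_cherry[OF finite_V]])
  qed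
  with \<open>\<mu> > 0\<close> show ?thesis by blast
qed

lemma C4_packing:
  fixes \<alpha> p :: real
  assumes "0 < \<alpha>" "0 < p" "p \<le> 1"
  shows "\<exists>\<mu>>0. \<exists>n0. \<forall>n\<ge>n0. \<forall>(V :: 'a set) E. dense_three_graph n p \<mu> \<alpha> V E \<longrightarrow> 6 dvd n \<longrightarrow>
    has_perfect_packing C4_verts C4_edges V E"
proof -
  define g where "g \<delta> = (p ^ 6 * \<delta>\<^sup>2 / 2) ^ (2 ^ 9)" for \<delta>
  define h where "h \<delta> = (p\<^sup>2 * \<delta> ^ 5 / 2)\<^sup>2" for \<delta>
  have "(p * \<alpha> / 8)\<^sup>2 > 0" "\<And>\<delta>. \<delta> > 0 \<Longrightarrow> g \<delta> > 0" "\<And>\<delta>. \<delta> > 0 \<Longrightarrow> h \<delta> > 0"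
    using assms by (simp_all add: g_def h_def)
  from packable_large[where 'a = 'a and g = g and h = h, OF this, where r = 5 and s = 17]
  obtain \<epsilon> n0 where "\<epsilon> > 0" and pack: "\<And>(V :: 'a set) tile spans. tile_system V tile spans 5 \<Longrightarrow> n0 \<le> card V \<Longrightarrow>
      abundant_tiles V tile 5 17 ((p * \<alpha> / 8)\<^sup>2) g h \<epsilon> \<Longrightarrow> Suc 5 dvd card V \<Longrightarrow> tile_system.packable spans V"
    by blast
  \<comment> \<open>The bounds serve, in this order, the tiles at a vertex, the exchanges and the
    tiles inside a set. The grid has 6 edges and the other pattern 2, hence the denominators 2 * 6
    and 2 * 2.\<close>
  define \<mu> where "\<mu> = min (p * \<alpha> / 8) (min (p ^ 6 * \<epsilon>\<^sup>2 / 12) (p\<^sup>2 * \<epsilon> ^ 5 / 4))"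
  have "\<mu> > 0" using assms \<open>\<epsilon> > 0\<close> by (simp add: \<mu>_def)
  have \<mu>: "6 * \<mu> \<le> p ^ 6 * \<delta>\<^sup>2 / 2" "2 * \<mu> \<le> p\<^sup>2 * \<delta> ^ 5 / 2" if "\<epsilon> \<le> \<delta>" for \<delta>
  proof -
    have "p ^ l * \<epsilon> ^ k \<le> p ^ l * \<delta> ^ k" for k l
      using that assms \<open>\<epsilon> > 0\<close> by (intro mult_left_mono power_mono) auto
    from this[of 6 2] this[of 2 5] show "6 * \<mu> \<le> p ^ 6 * \<delta>\<^sup>2 / 2" "2 * \<mu> \<le> p\<^sup>2 * \<delta> ^ 5 / 2"
      unfolding \<mu>_def by linarith+
  qed
  have "has_perfect_packing C4_verts C4_edges V E"
    if H: "dense_three_graph n p \<mu> \<alpha> V E" and n: "max n0 2 \<le> n" "6 dvd n" for n and V :: "'a set" and E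
  proof -
    interpret weakly_quasirandom V E p \<mu> by (rule weakly_quasirandom_if_dense[OF H])
    have H': "three_graph V E" "card V = n" "\<And>v. v \<in> V \<Longrightarrow> \<alpha> * real (n choose 2) \<le> real (vertex_degree E v)"
      using H by (auto simp: dense_three_graph_def)
    have "abundant_tiles V (C4_tile E) 5 17 ((p * \<alpha> / 8)\<^sup>2) g h \<epsilon>"
      unfolding abundant_tiles_def
    proof (intro conjI ballI allI impI)
      fix w assume "w \<in> V"
      then show "(p * \<alpha> / 8)\<^sup>2 * real (card V) ^ 5 \<le> real (card {Q \<in> tuples V 5. C4_tile E (add_mset w (mset Q))})"
        using assms \<open>\<mu> > 0\<close> H' n by (intro C4_tiles_at) (auto simp: \<mu>_def)
    next
      fix \<delta> X assume "\<epsilon> \<le> \<delta>" "X \<subseteq> V" "\<delta> * real (card V) \<le> real (card X)"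
      then have "h \<delta> * real (card V) ^ 6 \<le> real (card {xs \<in> tuples X 6. C4_tile E (mset xs)})"
        unfolding h_def using assms \<open>\<mu> > 0\<close> \<open>\<epsilon> > 0\<close> \<mu>(2)[of \<delta>] by (intro C4_tiles) linarith+
      then show "h \<delta> * real (card V) ^ Suc 5 \<le> real (card {xs \<in> tuples X (Suc 5). C4_tile E (mset xs)})"
        by simp
    next
      fix \<delta> X Y assume "\<epsilon> \<le> \<delta>" "X \<subseteq> V" "Y \<subseteq> V"
        "\<delta> * real (card V) \<le> real (card X)" "\<delta> * real (card V) \<le> real (card Y)"
      then have "g \<delta> * real (card V) ^ 19
          \<le> (\<Sum>x\<in>X. \<Sum>y\<in>Y. real (card (tile_system.swaps V (C4_tile E) 17 {#x#} {#y#})))"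
        unfolding g_def using assms \<open>\<mu> > 0\<close> \<open>\<epsilon> > 0\<close> \<mu>(1)[of \<delta>] by (intro C4_swaps) linarith+
      then show "g \<delta> * real (card V) ^ (17 + 2)
          \<le> (\<Sum>x\<in>X. \<Sum>y\<in>Y. real (card (tile_system.swaps V (C4_tile E) 17 {#x#} {#y#})))"
        by simp
    qed
    then have "tile_system.packable (spans_copy C4_verts C4_edges E) V"
      using H' n by (intro pack[OF tile_system_C4[OF finite_V]]) auto
    then show ?thesis
      by (simp add: has_perfect_packing_iff_packable[OF tile_system_C4[OF finite_V]])
  qed
  with \<open>\<mu> > 0\<close> show ?thesis by blast
qed

theorem theorem1p5:
  fixes \<alpha> p :: real
  assumes "0 < \<alpha>" and "\<alpha> < 1" and "0 < p" and "p < 1"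
  shows "\<exists>(n0::nat) (\<mu>::real). \<mu> > 0 \<and>
    (\<forall>n (V::'a set) (E::'a set set).
       n \<ge> n0 \<and> dense_three_graph n p \<mu> \<alpha> V E \<longrightarrow>
         (4 dvd n \<longrightarrow> has_perfect_packing cherry_verts cherry_edges V E) \<and>
         (6 dvd n \<longrightarrow> has_perfect_packing C4_verts C4_edges V E))"
proof -
  have p: "p \<le> 1" using assms by simp
  from cherry_packing[OF assms(1,3) p] obtain \<mu>1 n1 where 1: "\<mu>1 > 0"
    "\<And>n (V :: 'a set) E. n1 \<le> n \<Longrightarrow> dense_three_graph n p \<mu>1 \<alpha> V E \<Longrightarrow> 4 dvd n \<Longrightarrow>
      has_perfect_packing cherry_verts cherry_edges V E"
    by blast
  from C4_packing[OF assms(1,3) p] obtain \<mu>2 n2 where 2: "\<mu>2 > 0"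
    "\<And>n (V :: 'a set) E. n2 \<le> n \<Longrightarrow> dense_three_graph n p \<mu>2 \<alpha> V E \<Longrightarrow> 6 dvd n \<Longrightarrow>
      has_perfect_packing C4_verts C4_edges V E"
    by blast
  show ?thesis
  \<comment> \<open>A smaller \<mu> is a stronger assumption on the 3-graph, so the minimum serves
    both packings.\<close>
  proof (intro exI[of _ "max n1 n2"] exI[of _ "min \<mu>1 \<mu>2"] conjI allI impI)
    show "min \<mu>1 \<mu>2 > 0" using 1 2 by simp
    fix n and V :: "'a set" and E
    assume H: "max n1 n2 \<le> n \<and> dense_three_graph n p (min \<mu>1 \<mu>2) \<alpha> V E"
    show "has_perfect_packing cherry_verts cherry_edges V E" if "4 dvd n"
      using 1(2)[OF _ dense_three_graph_mono that] H by auto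
    show "has_perfect_packing C4_verts C4_edges V E" if "6 dvd n"
      using 2(2)[OF _ dense_three_graph_mono that] H by auto
  qed
qed

end
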